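(* Let $k\geq 2$ and let $\chi_1,\chi_2$ be primitive non-trivial Dirichlet characters with conductors $q_1,q_2$ such that $\chi_1\chi_2(-1)=(-1)^k$. Then the function $\widehat S_{\chi_1,\chi_2,k}$, restricted to the set $(\Gamma_1(q_1q_2))(\infty)$ of cusps $\Gamma_1(q_1q_2)$-equivalent to $\infty$, is a weight $2-k$ quantum modular form on $\Gamma_1(q_1q_2)$; that is, for every $\gamma\in\Gamma_1(q_1q_2)$ the function $$\mathfrak a\mapsto \widehat S_{\chi_1,\chi_2,k}(\mathfrak a)-j(\gamma,\mathfrak a)^{k-2}\,\widehat S_{\chi_1,\chi_2,k}(\gamma\mathfrak a),\qquad \mathfrak a\in(\Gamma_1(q_1q_2))(\infty)\setminus\{\infty\},$$ is continuous with respect to the real topology.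
   Context: Notation: $e(z)=\exp(2\pi i z)$; $\tau(\chi)$ denotes the Gauss sum of $\chi$; $j(\gamma,z)=cz+d$ for $\gamma=\begin{pmatrix} a&b\\ c&d\end{pmatrix}$. The Eisenstein series is $E_{\chi_1,\chi_2,k}(z)=2\sum_{N\geq 1}\sum_{A\mid N}\chi_1(A)\overline{\chi_2}(N/A)(N/A)^{k-1}e(Nz)$ for $z$ in the upper half plane $\mathcal H$; it satisfies $E_{\chi_1,\chi_2,k}(\gamma z)=\chi_1\overline{\chi_2}(d)(cz+d)^kE_{\chi_1,\chi_2,k}(z)$ for $\gamma\in\Gamma_0(q_1q_2)$. Let $P_{k-2}(z;X,Y)=(Xz+Y)^{k-2}$. Let $(\Gamma_0(q_1q_2))(\infty)=\{\gamma\infty:\gamma\in\Gamma_0(q_1q_2)\}\subseteq\mathbb P^1(\mathbb Q)$. Define $\widehat S_{\chi_1,\chi_2,k}:(\Gamma_0(q_1q_2))(\infty)\to\mathbb C$ by $\widehat S_{\chi_1,\chi_2,k}(\infty)=0$ and, for $\mathfrak a\neq\infty$, $$\widehat S_{\chi_1,\chi_2,k}(\mathfrak a)=(-1)^k\tau(\overline{\chi_1})(k-1)\int_\infty^{\mathfrak a}E_{\chi_1,\chi_2,k}(z)P_{k-2}(z;1,-\mathfrak a)\,dz.$$ A function $f$ on the cusps $\Gamma(\infty)$ equivalent to $\infty$ under a group $\Gamma$ is a weight $\kappa\le 0$ quantum modular form on $\Gamma$ if for each $\gamma\in\Gamma$ the function $\mathfrak a\mapsto f(\mathfrak a)-j(\gamma,\mathfrak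 a)^{-\kappa}f(\gamma\mathfrak a)$ on $\Gamma(\infty)\setminus\{\infty\}$ is continuous in the real topology. *)

theory Defs
  imports "HOL-Analysis.Analysis" "HOL-Number_Theory.Cong"
begin

definition dirichlet_char :: "nat \<Rightarrow> (int \<Rightarrow> complex) \<Rightarrow> bool" where
  "dirichlet_char q chi \<longleftrightarrow> q \<ge> 1 \<and>
     (\<forall>m n. chi (m * n) = chi m * chi n) \<and>
     (\<forall>n. chi (n + int q) = chi n) \<and>
     (\<forall>n. chi n \<noteq> 0 \<longleftrightarrow> coprime n (int q))"

definition primitive_dirichlet_char :: "nat \<Rightarrow> (int \<Rightarrow> complex) \<Rightarrow> bool" where
  "primitive_dirichlet_char q chi \<longleftrightarrow> dirichlet_char q chi \<and>
     (\<forall>d. d dvd q \<and> d < q \<longrightarrow>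
        \<not> (\<forall>m n. coprime m (int q) \<and> coprime n (int q) \<and> [m = n] (mod int d)
                 \<longrightarrow> chi m = chi n))"

definition nontrivial_dirichlet_char :: "nat \<Rightarrow> (int \<Rightarrow> complex) \<Rightarrow> bool" where
  "nontrivial_dirichlet_char q chi \<longleftrightarrow> (\<exists>n. coprime n (int q) \<and> chi n \<noteq> 1)"

definition ee :: "complex \<Rightarrow> complex" where
  "ee z = exp (2 * of_real pi * \<i> * z)"

definition gauss_sum :: "nat \<Rightarrow> (int \<Rightarrow> complex) \<Rightarrow> complex" where
  "gauss_sum q chi = (\<Sum>a<q. chi (int a) * ee (of_nat a / of_nat q))"

definition eis_coeff :: "(int \<Rightarrow> complex) \<Rightarrow> (int \<Rightarrow> complex) \<Rightarrow> nat \<Rightarrow> nat \<Rightarrow> complex" where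
  "eis_coeff chi1 chi2 k N =
     (\<Sum>A\<in>{A. A dvd N}. chi1 (int A) * cnj (chi2 (int (N div A))) * of_nat (N div A) ^ (k - 1))"

definition eisenstein :: "(int \<Rightarrow> complex) \<Rightarrow> (int \<Rightarrow> complex) \<Rightarrow> nat \<Rightarrow> complex \<Rightarrow> complex" where
  "eisenstein chi1 chi2 k z =
     2 * (\<Sum>n. eis_coeff chi1 chi2 k (Suc n) * ee (of_nat (Suc n) * z))"

text \<open>Points of P^1(Q) (inside P^1(R)): None is the cusp infinity, Some x a real point.
  Matrices (a,b,c,d) stand for [[a,b],[c,d]].\<close>

definition Gamma1 :: "nat \<Rightarrow> (int \<times> int \<times> int \<times> int) set" where
  "Gamma1 N = {(a,b,c,d). a * d - b * c = 1 \<and> [c = 0] (mod int N) \<and>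
                          [a = 1] (mod int N) \<and> [d = 1] (mod int N)}"

fun moeb :: "int \<times> int \<times> int \<times> int \<Rightarrow> real option \<Rightarrow> real option" where
  "moeb (a,b,c,d) None = (if c = 0 then None else Some (of_int a / of_int c))"
| "moeb (a,b,c,d) (Some x) =
     (if of_int c * x + of_int d = 0 then None
      else Some ((of_int a * x + of_int b) / (of_int c * x + of_int d)))"

fun jfac :: "int \<times> int \<times> int \<times> int \<Rightarrow> real \<Rightarrow> real" where
  "jfac (a,b,c,d) x = of_int c * x + of_int d"

definition cusp_orbit_inf :: "(int \<times> int \<times> int \<times> int) set \<Rightarrow> real option set" where
  "cusp_orbit_inf G = {moeb g None | g. g \<in> G}"

text \<open>Integral from infinity to a real point a along the vertical ray z = a + i t:
  int_inf^a f(z) dz = - int_0^inf f(a + i t) i dt.\<close>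
definition integral_inf_to :: "(complex \<Rightarrow> complex) \<Rightarrow> real \<Rightarrow> complex" where
  "integral_inf_to f a = - integral {0<..} (\<lambda>t::real. f (of_real a + \<i> * of_real t) * \<i>)"

definition S_hat :: "(int \<Rightarrow> complex) \<Rightarrow> (int \<Rightarrow> complex) \<Rightarrow> nat \<Rightarrow> nat \<Rightarrow> real option \<Rightarrow> complex" where
  "S_hat chi1 chi2 k q1 cusp = (case cusp of None \<Rightarrow> 0
     | Some a \<Rightarrow> (-1) ^ k * gauss_sum q1 (\<lambda>n. cnj (chi1 n)) * of_nat (k - 1) *
         integral_inf_to (\<lambda>z. eisenstein chi1 chi2 k z * (z - of_real a) ^ (k - 2)) a)"

definition quantum_modular_form ::
  "(int \<times> int \<times> int \<times> int) set \<Rightarrow> int \<Rightarrow> (real option \<Rightarrow> complex) \<Rightarrow> bool" where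
  "quantum_modular_form G \<kappa> f \<longleftrightarrow> \<kappa> \<le> 0 \<and>
     (\<forall>g\<in>G. continuous_on {x. Some x \<in> cusp_orbit_inf G}
        (\<lambda>x. f (Some x) - complex_of_real (jfac g x) powi (- \<kappa>) * f (moeb g (Some x))))"

end

theory Submission
  imports Defs "HOL-Real_Asymp.Real_Asymp"
begin

text \<open>
  With \<open>I(z; u, v)\<close> the primitive of \<open>E(z) (u z + v) ^ (k - 2)\<close> that vanishes at \<open>i \<infinity>\<close>, the modularity of
  \<open>E\<close> shows that \<open>I(g z; u, v)\<close> and \<open>I(z; (u, v) g)\<close> differ by a constant, and this constant is the integral
  of \<open>E(z) (u z + v) ^ (k - 2)\<close> from \<open>\<infinity>\<close> to \<open>g \<infinity>\<close>. Hence the defect of modularity of the Eichler integral at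
  the cusp \<open>x\<close> is \<open>I(i; 1, -x) - I(g i; c x + d, -(a x + b))\<close>, a polynomial in \<open>x\<close>.

  The modularity of \<open>E\<close> comes from a lattice sum. Writing \<open>cnj \<chi>2\<close> as a finite Fourier series and using the
  Lipschitz formula, \<open>E(z)\<close> becomes a multiple of the sum of \<open>\<chi>1(A) g(d) (A q2 z + d) ^ (-k)\<close>, where \<open>g\<close> is
  periodic modulo \<open>q2\<close> with mean value zero. Summation by parts in \<open>d\<close> makes it absolutely convergent also for
  \<open>k = 2\<close>. Matrices in \<open>\<Gamma>1(q1 q2)\<close> permute the lattice points within their residue classes.
\<close>

subsection \<open>q-series vanishing at infinity\<close>

text \<open>The cancellation that isolates the defect: let \<open>x\<close> be the image of infinity
  under \<open>h\<close>. The path to \<open>x\<close> is cut at \<open>w\<close>, the image of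
  \<open>\<i>\<close> under \<open>h\<close>, and the path to \<open>g x\<close> at
  \<open>g w\<close>. Pulled back by \<open>h\<close> and by \<open>g h\<close>, the two tails
  become the same primitive at \<open>\<i>\<close> with the same linear form, since
  \<open>z - g x\<close> times \<open>j(g, x)\<close> pulls back to \<open>z - x\<close>. The tails
  cancel, and what remains turns out not to depend on \<open>w\<close>. This matters because
  \<open>w\<close> varies with \<open>x\<close>: only after \<open>w\<close> is replaced by
  \<open>\<i>\<close> does \<open>x\<close> enter through the coefficients of linear forms alone.

  The primitive is given explicitly, so that independence of the path reduces to functions with
  equal derivatives on a convex set.

  The lattice sum is taken at \<open>q2 z\<close> because this splits the level. The matrix acting
  on \<open>q2 z\<close> has upper right entry \<open>b q2\<close> and lower left entry
  \<open>c / q2\<close>; the first is divisible by \<open>q2\<close>, the second by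
  \<open>q1\<close>. These are the congruences that preserve a weight with period \<open>q1\<close>
  in \<open>A\<close> and period \<open>q2\<close> in \<open>d\<close>.\<close>

definition uhp :: "complex set" where
  "uhp = {z. Im z > 0}"

lemma convex_uhp: "convex uhp"
  unfolding uhp_def by (rule convex_halfspace_Im_gt)

lemma ee_add: "ee (z + w) = ee z * ee w"
  by (simp add: ee_def ring_distribs exp_add)

lemma ee_of_nat_mult: "ee (of_nat n * z) = ee z ^ n"
  unfolding ee_def exp_of_nat_mult [symmetric] by (simp add: mult_ac)

lemma ee_of_int: "ee (of_int n) = 1"
  unfolding ee_def using exp_integer_2pi[of "of_int n"] by (simp add: mult_ac)

lemma norm_ee: "norm (ee z) = exp (- 2 * pi * Im z)"
  by (simp add: ee_def)

lemma norm_ee_less_1: "z \<in> uhp \<Longrightarrow> norm (ee z) < 1"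
  by (simp add: norm_ee uhp_def)

lemma has_field_derivative_ee:
  "(ee has_field_derivative 2 * of_real pi * \<i> * ee z) (at z within A)"
  unfolding ee_def by (auto intro!: derivative_eq_intros)

definition disc_summable :: "(nat \<Rightarrow> complex) \<Rightarrow> bool" where
  "disc_summable c \<longleftrightarrow> (\<forall>q. norm q < 1 \<longrightarrow> summable (\<lambda>n. c n * q ^ n))"

text \<open>Index \<open>n\<close> carries the exponent \<open>Suc n\<close>: a constant term cannot
  occur, so decay at infinity is built into the form.\<close>

definition qseries :: "(nat \<Rightarrow> complex) \<Rightarrow> complex \<Rightarrow> complex" where
  "qseries c z = (\<Sum>n. c n * ee (of_nat (Suc n) * z))"

definition anti_coeff :: "(nat \<Rightarrow> complex) \<Rightarrow> nat \<Rightarrow> complex" where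
  "anti_coeff c n = c n / (2 * of_real pi * \<i> * of_nat (Suc n))"

lemma qseries_altdef:
  assumes "disc_summable c" "z \<in> uhp"
  shows "qseries c z = ee z * (\<Sum>n. c n * ee z ^ n)"
proof -
  have "qseries c z = (\<Sum>n. ee z * (c n * ee z ^ n))"
    unfolding qseries_def ee_of_nat_mult by (simp add: mult_ac)
  also have "\<dots> = ee z * (\<Sum>n. c n * ee z ^ n)"
    using assms norm_ee_less_1 by (intro suminf_mult) (auto simp: disc_summable_def)
  finally show ?thesis .
qed

text \<open>The divisors have modulus at least 1, so every term shrinks. The comparison needs
  absolute convergence, which comes from convergence at the larger radius \<open>r\<close>.\<close>

lemma disc_summable_anti_coeff:
  assumes "disc_summable c"
  shows "disc_summable (anti_coeff c)"
  unfolding disc_summable_def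
proof (intro allI impI)
  fix q :: complex assume q: "norm q < 1"
  define r where "r = (norm q + 1) / 2"
  have r: "norm q < r" "r < 1" using q by (auto simp: r_def)
  have "r > 0" using r norm_ge_zero[of q] by linarith
  have "summable (\<lambda>n. c n * of_real r ^ n)"
    using assms r \<open>r > 0\<close> unfolding disc_summable_def by auto
  hence S: "summable (\<lambda>n. norm (c n * q ^ n))"
    by (rule powser_insidea) (use r \<open>r > 0\<close> in auto)
  show "summable (\<lambda>n. anti_coeff c n * q ^ n)"
  proof (rule summable_comparison_test'[OF S, of 0])
    fix n :: nat
    have "1 \<le> 2 * pi * real (Suc n)"
      using pi_gt3 by (intro order.trans[OF _ mult_mono[of 1 "2*pi" 1 "real (Suc n)"]]) auto
    hence "norm (c n) / (2 * pi * real (Suc n)) \<le> norm (c n) / 1"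
      by (intro divide_left_mono) auto
    thus "norm (anti_coeff c n * q ^ n) \<le> norm (c n * q ^ n)"
      using mult_right_mono[of "norm (c n) / (2 * pi * real (Suc n))" "norm (c n)" "norm (q ^ n)"]
      by (simp add: anti_coeff_def norm_mult norm_divide del: of_nat_Suc)
  qed
qed

lemma has_field_derivative_qseries_anti:
  assumes c: "disc_summable c" and z: "z \<in> uhp"
  shows "(qseries (anti_coeff c) has_field_derivative qseries c z) (at z)"
proof -
  \<comment> \<open>Shifting the index gives an ordinary power series with constant term 0, to which
    termwise differentiation applies.\<close>
  define d where "d n = (case n of 0 \<Rightarrow> 0 | Suc m \<Rightarrow> anti_coeff c m)" for n
  have sm: "summable (\<lambda>n. d n * q ^ n)" if "norm q < 1" for q
  proof -
    have "summable (\<lambda>n. q * (anti_coeff c n * q ^ n))"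
      using disc_summable_anti_coeff[OF c] that
      by (intro summable_mult) (auto simp: disc_summable_def)
    hence "summable (\<lambda>n. d (Suc n) * q ^ Suc n)"
      by (simp add: d_def mult_ac)
    thus ?thesis by (subst (asm) summable_Suc_iff)
  qed
  have eq: "qseries (anti_coeff c) w = (\<Sum>n. d n * ee w ^ n)" if "w \<in> uhp" for w
  proof -
    have "(\<Sum>n. d n * ee w ^ n) = (\<Sum>n. d (Suc n) * ee w ^ Suc n)"
      using suminf_split_head[OF sm[OF norm_ee_less_1[OF that]]] by (simp add: d_def)
    thus ?thesis by (simp add: d_def qseries_def ee_of_nat_mult[symmetric] del: of_nat_Suc power_Suc)
  qed
  have "((\<lambda>q. \<Sum>n. d n * q ^ n) has_field_derivative (\<Sum>n. diffs d n * ee z ^ n)) (at (ee z))"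
    by (rule termdiffs_strong'[of 1]) (use sm norm_ee_less_1[OF z] in auto)
  from DERIV_chain2[OF this has_field_derivative_ee]
  have "((\<lambda>w. \<Sum>n. d n * ee w ^ n) has_field_derivative
           (\<Sum>n. diffs d n * ee z ^ n) * (2 * of_real pi * \<i> * ee z)) (at z)" .
  also have "diffs d = (\<lambda>n. (1 / (2 * of_real pi * \<i>)) * c n)"
    by (auto simp: diffs_def d_def anti_coeff_def field_simps simp del: of_nat_Suc)
  also have "(\<Sum>n. (1 / (2 * of_real pi * \<i>)) * c n * ee z ^ n)
      = (1 / (2 * of_real pi * \<i>)) * (\<Sum>n. c n * ee z ^ n)"
    unfolding mult.assoc
    using c norm_ee_less_1[OF z] by (intro suminf_mult) (auto simp: disc_summable_def)
  also have "\<dots> * (2 * of_real pi * \<i> * ee z) = qseries c z"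
    by (subst qseries_altdef[OF c z]) (simp add: field_simps)
  finally show ?thesis
    by (rule has_field_derivative_transform_within_open[of _ _ _ uhp])
       (use z eq in \<open>auto simp: uhp_def open_halfspace_Im_gt\<close>)
qed

lemma continuous_on_qseries:
  assumes "disc_summable c"
  shows "continuous_on uhp (qseries c)"
proof -
  have "isCont (\<lambda>q. \<Sum>n. c n * q ^ n) q" if "norm q < 1" for q
    by (rule DERIV_isCont, rule termdiffs_strong'[of 1])
       (use assms that in \<open>auto simp: disc_summable_def\<close>)
  hence "continuous_on {q. norm q < 1} (\<lambda>q. \<Sum>n. c n * q ^ n)"
    by (auto intro!: continuous_at_imp_continuous_on)
  moreover have "continuous_on uhp ee"
    by (rule DERIV_continuous_on, rule has_field_derivative_ee)
  ultimately have "continuous_on uhp (\<lambda>z. \<Sum>n. c n * ee z ^ n)" "continuous_on uhp ee"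
    by (auto intro: continuous_on_compose2[where g = "\<lambda>q. \<Sum>n. c n * q ^ n"] dest: norm_ee_less_1)
  hence "continuous_on uhp (\<lambda>z. ee z * (\<Sum>n. c n * ee z ^ n))"
    by (intro continuous_on_mult)
  thus ?thesis
    by (subst continuous_on_cong[OF refl qseries_altdef[OF assms]])
qed

text \<open>Once a factor \<open>ee z\<close> is split off, the remaining power series is continuous
  on the compact disc of radius \<open>exp (-2*pi)\<close>, into which \<open>ee\<close> maps the
  region \<open>Im z \<ge> 1\<close>.\<close>

lemma qseries_bound:
  assumes "disc_summable c"
  obtains C where "C \<ge> 0" "\<And>z. Im z \<ge> 1 \<Longrightarrow> norm (qseries c z) \<le> C * exp (- 2 * pi * Im z)"
proof -
  have cont: "continuous_on (cball 0 (exp (-2*pi))) (\<lambda>q. \<Sum>n. c n * q ^ n)"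
  proof (intro continuous_at_imp_continuous_on ballI)
    fix q :: complex assume "q \<in> cball 0 (exp (-2*pi))"
    hence "norm q < 1"
      by (simp, intro le_less_trans[of "norm q" "exp (-2*pi)" 1]) auto
    thus "isCont (\<lambda>q. \<Sum>n. c n * q ^ n) q"
      by (intro DERIV_isCont[OF termdiffs_strong'[of 1]])
         (use assms in \<open>auto simp: disc_summable_def\<close>)
  qed
  hence "bounded ((\<lambda>q. \<Sum>n. c n * q ^ n) ` cball 0 (exp (-2*pi)))"
    by (intro compact_imp_bounded compact_continuous_image) auto
  then obtain C where C: "\<And>q. norm q \<le> exp (-2*pi) \<Longrightarrow> norm (\<Sum>n. c n * q ^ n) \<le> C"
    unfolding bounded_iff by force
  show ?thesis
  proof (rule that[of C])
    show "C \<ge> 0" using order.trans[OF norm_ge_zero C[of 0]] by simp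
  next
    fix z :: complex assume z: "Im z \<ge> 1"
    hence "norm (ee z) \<le> exp (-2*pi)" by (simp add: norm_ee)
    hence "norm (\<Sum>n. c n * ee z ^ n) \<le> C" by (rule C)
    moreover have "z \<in> uhp" using z by (simp add: uhp_def)
    ultimately show "norm (qseries c z) \<le> C * exp (- 2 * pi * Im z)"
      using assms by (simp add: qseries_altdef norm_mult norm_ee mult.commute mult_right_mono)
  qed
qed

text \<open>The recursion is integration by parts.\<close>
fun qprim :: "nat \<Rightarrow> (nat \<Rightarrow> complex) \<Rightarrow> complex \<Rightarrow> complex \<Rightarrow> complex \<Rightarrow> complex" where
  "qprim 0 c \<alpha> \<beta> z = qseries (anti_coeff c) z"
| "qprim (Suc m) c \<alpha> \<beta> z = qseries (anti_coeff c) z * (\<alpha> * z + \<beta>) ^ Suc m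
     - of_nat (Suc m) * \<alpha> * qprim m (anti_coeff c) \<alpha> \<beta> z"

lemma has_field_derivative_qprim:
  assumes "disc_summable c" "z \<in> uhp"
  shows "(qprim m c \<alpha> \<beta> has_field_derivative qseries c z * (\<alpha> * z + \<beta>) ^ m) (at z)"
  using assms(1)
proof (induction m arbitrary: c)
  case 0
  thus ?case using has_field_derivative_qseries_anti assms(2) by simp
next
  case (Suc m)
  note D = has_field_derivative_qseries_anti[OF Suc.prems assms(2)]
  note D' = Suc.IH[OF disc_summable_anti_coeff[OF Suc.prems]]
  have P: "((\<lambda>z. (\<alpha> * z + \<beta>) ^ Suc m) has_field_derivative of_nat (Suc m) * \<alpha> * (\<alpha> * z + \<beta>) ^ m) (at z)"
    by (rule derivative_eq_intros refl)+ simp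
  have "((\<lambda>z. qseries (anti_coeff c) z * (\<alpha> * z + \<beta>) ^ Suc m
     - of_nat (Suc m) * \<alpha> * qprim m (anti_coeff c) \<alpha> \<beta> z) has_field_derivative
     (qseries c z * (\<alpha> * z + \<beta>) ^ Suc m +
        (of_nat (Suc m) * \<alpha> * (\<alpha> * z + \<beta>) ^ m) * qseries (anti_coeff c) z
      - of_nat (Suc m) * \<alpha> * (qseries (anti_coeff c) z * (\<alpha> * z + \<beta>) ^ m))) (at z)"
    by (rule DERIV_diff[OF DERIV_mult[OF D P] DERIV_cmult[OF D']])
  thus ?case by (simp add: mult_ac del: power_Suc of_nat_Suc)
qed

lemma norm_qseries_power_le:
  assumes "disc_summable c"
  obtains K where "\<And>t. t \<ge> 1 \<Longrightarrow>
    norm (qseries c (of_real u + \<i> * of_real t) * (\<alpha> * (of_real u + \<i> * of_real t) + \<beta>) ^ m)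
      \<le> K * (exp (- 2 * pi * t) * (1 + t) ^ m)"
proof -
  obtain C where C: "C \<ge> 0" "\<And>z. Im z \<ge> 1 \<Longrightarrow> norm (qseries c z) \<le> C * exp (- 2 * pi * Im z)"
    using qseries_bound[OF assms] by blast
  define B where "B = norm \<alpha> * (\<bar>u\<bar> + 1) + norm \<beta>"
  have "B \<ge> 0" by (simp add: B_def)
  show ?thesis
  proof (rule that[of "C * B ^ m"])
    fix t :: real assume t: "t \<ge> 1"
    define z where "z = of_real u + \<i> * complex_of_real t"
    have "norm z \<le> \<bar>u\<bar> + t"
      unfolding z_def using t norm_triangle_ineq[of "of_real u" "\<i> * complex_of_real t"]
      by (simp add: norm_mult)
    also have "\<dots> \<le> (\<bar>u\<bar> + 1) * (1 + t)"
      using t by (simp add: algebra_simps)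
    finally have "norm (\<alpha> * z) \<le> norm \<alpha> * (\<bar>u\<bar> + 1) * (1 + t)"
      by (simp add: norm_mult mult_left_mono mult.assoc)
    moreover have "norm \<beta> * 1 \<le> norm \<beta> * (1 + t)"
      using t by (intro mult_left_mono) auto
    ultimately have "norm (\<alpha> * z + \<beta>) \<le> B * (1 + t)"
      using norm_triangle_ineq[of "\<alpha> * z" \<beta>] by (simp add: B_def algebra_simps)
    hence "norm ((\<alpha> * z + \<beta>) ^ m) \<le> (B * (1 + t)) ^ m"
      by (simp add: norm_power power_mono)
    moreover have "norm (qseries c z) \<le> C * exp (- 2 * pi * t)"
      using C(2)[of z] t by (simp add: z_def)
    ultimately have "norm (qseries c z) * norm ((\<alpha> * z + \<beta>) ^ m)
        \<le> (C * exp (- 2 * pi * t)) * (B * (1 + t)) ^ m"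
      using C(1) by (intro mult_mono) auto
    thus "norm (qseries c z * (\<alpha> * z + \<beta>) ^ m) \<le> C * B ^ m * (exp (- 2 * pi * t) * (1 + t) ^ m)"
      by (simp add: norm_mult power_mult_distrib mult_ac)
  qed
qed

text \<open>The extra factor \<open>exp t\<close> is affordable since \<open>2 * pi > 1\<close>.
  Decay in this form is what \<open>integral_positive_reals_FTC\<close> turns into an integrable
  majorant.\<close>

lemma tendsto_exp_qseries_power:
  assumes "disc_summable c"
  shows "((\<lambda>t. exp t *\<^sub>R (qseries c (of_real u + \<i> * of_real t)
            * (\<alpha> * (of_real u + \<i> * of_real t) + \<beta>) ^ m)) \<longlongrightarrow> 0) at_top"
proof -
  obtain K where K: "\<And>t. t \<ge> 1 \<Longrightarrow>
    norm (qseries c (of_real u + \<i> * of_real t) * (\<alpha> * (of_real u + \<i> * of_real t) + \<beta>) ^ m)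
      \<le> K * (exp (- 2 * pi * t) * (1 + t) ^ m)"
    using norm_qseries_power_le[OF assms] by blast
  have "((\<lambda>t::real. exp t * exp (- 2 * pi * t) * (1 + t) ^ m) \<longlongrightarrow> 0) at_top"
    using pi_gt3 by real_asymp
  hence "((\<lambda>t::real. K * (exp t * exp (- 2 * pi * t) * (1 + t) ^ m)) \<longlongrightarrow> 0) at_top"
    by (rule tendsto_mult_right_zero)
  thus ?thesis
    by (rule Lim_null_comparison[rotated])
       (use K in \<open>auto intro!: eventually_mono[OF eventually_ge_at_top[of 1]] simp: mult_ac\<close>)
qed

lemma tendsto_qseries_power:
  assumes "disc_summable c"
  shows "((\<lambda>t. qseries c (of_real u + \<i> * of_real t)
            * (\<alpha> * (of_real u + \<i> * of_real t) + \<beta>) ^ m) \<longlongrightarrow> 0) at_top"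
proof -
  have "((\<lambda>t::real. exp (-t)) \<longlongrightarrow> 0) at_top" by real_asymp
  from tendsto_scaleR[OF this tendsto_exp_qseries_power[OF assms]]
  show ?thesis by (simp add: exp_minus)
qed

lemma tendsto_qprim:
  assumes "disc_summable c"
  shows "((\<lambda>t. qprim m c \<alpha> \<beta> (of_real u + \<i> * of_real t)) \<longlongrightarrow> 0) at_top"
  using assms
proof (induction m arbitrary: c)
  case 0
  show ?case
    using tendsto_qseries_power[OF disc_summable_anti_coeff[OF 0], of u \<alpha> \<beta> 0] by simp
next
  case (Suc m)
  from disc_summable_anti_coeff[OF Suc.prems] have a: "disc_summable (anti_coeff c)" .
  have "((\<lambda>t. qseries (anti_coeff c) (of_real u + \<i> * of_real t)
            * (\<alpha> * (of_real u + \<i> * of_real t) + \<beta>) ^ Suc m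
         - of_nat (Suc m) * \<alpha> * qprim m (anti_coeff c) \<alpha> \<beta> (of_real u + \<i> * of_real t))
         \<longlongrightarrow> 0 - of_nat (Suc m) * \<alpha> * 0) at_top"
    by (intro tendsto_diff tendsto_mult[OF tendsto_const] tendsto_qseries_power Suc.IH a)
  thus ?case by (simp del: of_nat_Suc power_Suc)
qed

text \<open>Each integration by parts trades one power of the linear form for one factor
  \<open>\<alpha>\<close>, so the total degree stays \<open>m\<close>. This lets
  \<open>j(g, x) ^ (k - 2)\<close> be absorbed into the coefficients.\<close>

lemma qprim_scale: "qprim m c (s * \<alpha>) (s * \<beta>) z = s ^ m * qprim m c \<alpha> \<beta> z"
proof (induction m arbitrary: c)
  case (Suc m)
  have "s * \<alpha> * z + s * \<beta> = s * (\<alpha> * z + \<beta>)" by (simp add: algebra_simps)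
  thus ?case
    by (simp add: Suc.IH power_mult_distrib del: of_nat_Suc) (simp add: algebra_simps)
qed auto

text \<open>At fixed \<open>z\<close> the recursion is polynomial in the coefficients of the linear
  form. The continuity of the defect in the cusp comes from here.\<close>

lemma continuous_on_qprim:
  assumes "continuous_on S A" "continuous_on S B"
  shows "continuous_on S (\<lambda>x. qprim m c (A x) (B x) z)"
proof (induction m arbitrary: c)
  case (Suc m)
  show ?case
    unfolding qprim.simps by (intro continuous_intros assms Suc.IH)
qed auto

text \<open>The limits of \<open>f\<close> at both ends bound it by a multiple of
  \<open>exp (-t)\<close> on the half line. This gives absolute integrability, after which the
  fundamental theorem applies with the one-sided limits of \<open>F\<close> as boundary
  values.\<close>

lemma integral_positive_reals_FTC:
  fixes f F :: "real \<Rightarrow> complex"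
  assumes cont: "continuous_on {0<..} f"
    and deriv: "\<And>t. t > 0 \<Longrightarrow> (F has_vector_derivative f t) (at t)"
    and top: "((\<lambda>t. exp t *\<^sub>R f t) \<longlongrightarrow> 0) at_top"
    and zero: "(f \<longlongrightarrow> 0) (at_right 0)"
    and A: "(F \<longlongrightarrow> A) (at_right 0)" and B: "(F \<longlongrightarrow> B) at_top"
  shows "integral {0<..} f = B - A"
proof -
  define g where "g t = exp t *\<^sub>R f t" for t
  have cont_g: "continuous_on {0<..} g"
    unfolding g_def by (intro continuous_intros cont)
  have "(g \<longlongrightarrow> exp 0 *\<^sub>R 0) (at_right 0)"
    unfolding g_def by (intro tendsto_intros zero)
  hence "eventually (\<lambda>t. norm (g t) < 1) (at_right 0)"
    by (intro order_tendstoD[OF tendsto_norm_zero]) auto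
  then obtain a where a: "a > 0" "\<And>t. 0 < t \<Longrightarrow> t < a \<Longrightarrow> norm (g t) < 1"
    by (auto simp: eventually_at_right_field)
  have "eventually (\<lambda>t. norm (g t) < 1) at_top"
    using top unfolding g_def by (intro order_tendstoD[OF tendsto_norm_zero]) auto
  then obtain b where b: "\<And>t. t \<ge> b \<Longrightarrow> norm (g t) < 1"
    by (auto simp: eventually_at_top_linorder)
  have "bounded (g ` {a..b})"
    using a(1) by (intro compact_imp_bounded compact_continuous_image continuous_on_subset[OF cont_g]) auto
  then obtain K where K: "\<And>t. t \<in> {a..b} \<Longrightarrow> norm (g t) \<le> K"
    unfolding bounded_iff by force
  \<comment> \<open>\<open>K\<close> serves on the compact middle piece, 1 serves near 0 and near
    infinity.\<close>
  have bound: "norm (f t) \<le> max K 1 * exp (-t)" if "t > 0" for t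
  proof -
    have "norm (g t) \<le> max K 1"
    proof (cases "t < a")
      case True thus ?thesis using a(2)[of t] that by auto
    next
      case False thus ?thesis using K[of t] b[of t] by (cases "t \<le> b") auto
    qed
    thus ?thesis by (simp add: g_def exp_minus field_simps)
  qed
  have meas: "f \<in> borel_measurable (lebesgue_on {0<..})"
    by (intro continuous_imp_measurable_on_sets_lebesgue cont) auto
  have "(\<lambda>t::real. exp (-1 * t)) integrable_on {0..}"
    by (rule integrable_on_exp_minus_to_infinity) auto
  hence "(\<lambda>t::real. exp (- t)) integrable_on {0<..}"
    by (subst integrable_spike_set_eq[where T = "{0..}"])
       (auto intro: negligible_subset[of "{0}"])
  hence "(\<lambda>t::real. max K 1 * exp (- t)) integrable_on {0<..}"
    by (intro integrable_on_mult_right)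
  hence "f absolutely_integrable_on {0<..}"
    by (intro measurable_bounded_by_integrable_imp_absolutely_integrable[OF meas _ _ bound]) auto
  \<comment> \<open>Borel measurability carries the integrability over from \<open>lebesgue\<close>
    to \<open>lborel\<close>.\<close>
  moreover have "(\<lambda>t. indicator {0<..} t *\<^sub>R f t) \<in> borel_measurable lborel"
    using borel_measurable_continuous_on_indicator[OF _ cont] by simp
  ultimately have si: "set_integrable lborel {0<..} f"
    unfolding set_integrable_def by (simp add: integrable_completion)
  have e: "einterval 0 \<infinity> = {0<..}" by (auto simp: einterval_def)
  have "(LBINT t=0..\<infinity>. f t) = B - A"
  proof (rule interval_integral_FTC_integrable)
    show "set_integrable lborel (einterval 0 \<infinity>) f" using si e by simp
    show "isCont f t" if "0 < ereal t" "ereal t < \<infinity>" for t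
      using cont that by (auto simp: continuous_on_eq_continuous_at)
  qed (use deriv A B in \<open>auto simp: ereal_tendsto_simps zero_ereal_def\<close>)
  also have "(LBINT t=0..\<infinity>. f t) = integral {0<..} f"
    using set_borel_integral_eq_integral(2)[OF si] by (simp add: interval_lebesgue_integral_def e)
  finally show ?thesis .
qed

subsection \<open>The Lipschitz formula\<close>

text \<open>Splitting at \<open>- 1 - n\<close> matches a sum over \<open>z + d\<close> with
  Polygamma series at \<open>z\<close> and at \<open>1 - z\<close>.\<close>

lemma range_int_halves: "range int \<union> range (\<lambda>n. - 1 - int n) = UNIV"
proof (safe; simp)
  fix x :: int assume "x \<notin> range (\<lambda>n. - 1 - int n)"
  hence "x \<noteq> - 1 - int (nat (- 1 - x))" by blast
  hence "x = int (nat x)" by linarith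
  thus "x \<in> range int" by blast
qed

lemma has_sum_int_halves:
  fixes f :: "int \<Rightarrow> complex"
  assumes "((\<lambda>n. f (int n)) has_sum a) UNIV" "((\<lambda>n. f (- 1 - int n)) has_sum b) UNIV"
  shows "(f has_sum (a + b)) UNIV"
proof -
  have "(f has_sum a) (range int)"
    using assms(1) by (subst has_sum_reindex) (auto simp: o_def)
  moreover have "(f has_sum b) (range (\<lambda>n. - 1 - int n))"
    using assms(2) by (subst has_sum_reindex) (auto simp: o_def inj_on_def)
  ultimately have "(f has_sum (a + b)) (range int \<union> range (\<lambda>n. - 1 - int n))"
    by (rule has_sum_Un_disjoint) auto
  thus ?thesis by (simp only: range_int_halves)
qed

lemma summable_on_int_powr:
  assumes "s < - 1"
  shows "(\<lambda>n::int. (1 + \<bar>real_of_int n\<bar>) powr s) summable_on UNIV"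
proof -
  let ?f = "\<lambda>n::int. (1 + \<bar>real_of_int n\<bar>) powr s"
  have "summable (\<lambda>n. real (Suc n) powr s)"
    using assms by (subst summable_Suc_iff) (simp add: summable_real_powr_iff)
  hence *: "(\<lambda>n. real (Suc n) powr s) summable_on UNIV"
    by (intro summable_nonneg_imp_summable_on) auto
  have "summable (\<lambda>n. real (Suc (Suc n)) powr s)"
    using assms by (subst summable_Suc_iff, subst summable_Suc_iff) (simp add: summable_real_powr_iff)
  hence "(\<lambda>n. real (Suc (Suc n)) powr s) summable_on UNIV"
    by (intro summable_nonneg_imp_summable_on) auto
  moreover have "\<bar>real_of_int (- 1 - int n)\<bar> = 1 + real n" for n by simp
  ultimately have **: "(\<lambda>n. ?f (- 1 - int n)) summable_on UNIV"
    by (simp add: add_ac)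
  have "?f summable_on (range int \<union> range (\<lambda>n. - 1 - int n))"
    by (intro summable_on_union)
       (use * ** in \<open>auto simp: summable_on_reindex o_def inj_on_def add_ac\<close>)
  thus ?thesis by (simp only: range_int_halves)
qed

lemma norm_lattice_point_ge:
  assumes "\<tau> \<in> uhp"
  obtains K where "K > 0"
    "\<And>A d :: int. A \<noteq> 0 \<Longrightarrow> 1 + \<bar>real_of_int A\<bar> + \<bar>real_of_int d\<bar> \<le> K * norm (of_int A * \<tau> + of_int d)"
proof -
  define y where "y = Im \<tau>"
  have y: "y > 0" using assms by (simp add: y_def uhp_def)
  \<comment> \<open>\<open>K / 2\<close> collects the bounds for \<open>A\<close> (imaginary part)
    and \<open>d\<close> (triangle inequality); the factor 2 pays for the summand 1, as
    \<open>A\<close> has absolute value at least 1.\<close>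
  define K where "K = 2 * (1 / y + 1 + norm \<tau> / y)"
  show ?thesis
  proof (rule that[of K])
    show "K > 0" using y by (simp add: K_def add_pos_nonneg)
    fix A d :: int assume A: "A \<noteq> 0"
    define N where "N = norm (of_int A * \<tau> + of_int d)"
    have "\<bar>Im (of_int A * \<tau> + of_int d)\<bar> \<le> N" unfolding N_def by (rule abs_Im_le_cmod)
    hence 1: "\<bar>real_of_int A\<bar> \<le> N / y" using y by (simp add: y_def abs_mult field_simps)
    have "\<bar>real_of_int d\<bar> = norm ((of_int A * \<tau> + of_int d) - of_int A * \<tau>)" by simp
    also have "\<dots> \<le> N + \<bar>real_of_int A\<bar> * norm \<tau>"
      unfolding N_def by (rule order.trans[OF norm_triangle_ineq4]) (simp add: norm_mult)
    also have "\<dots> \<le> N + N / y * norm \<tau>"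
      using 1 by (intro add_mono mult_right_mono) auto
    finally have 2: "\<bar>real_of_int d\<bar> \<le> N + N / y * norm \<tau>" .
    have "K / 2 * N = N / y + N + N / y * norm \<tau>"
      by (simp add: K_def field_simps)
    with 1 2 have 2: "\<bar>real_of_int A\<bar> + \<bar>real_of_int d\<bar> \<le> K / 2 * N" by linarith
    have "\<bar>real_of_int A\<bar> \<ge> 1" using A by linarith
    thus "1 + \<bar>real_of_int A\<bar> + \<bar>real_of_int d\<bar> \<le> K * norm (of_int A * \<tau> + of_int d)"
      using 2 unfolding N_def by linarith
  qed
qed

text \<open>The lower bound is demanded only where \<open>h\<close> is nonzero, so zeros of
  \<open>g\<close> are allowed where the weight vanishes. The same estimate then serves rows and
  columns of the lattice.\<close>

lemma summable_on_weighted_inverse_power: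
  fixes g h :: "int \<Rightarrow> complex"
  assumes k: "k \<ge> 2" and K: "K > 0" and M: "\<And>j. norm (h j) \<le> M"
    and ge: "\<And>j. h j \<noteq> 0 \<Longrightarrow> 1 + \<bar>real_of_int j\<bar> \<le> K * norm (g j)"
  shows "(\<lambda>j. norm (h j * (1 / g j ^ k))) summable_on UNIV"
proof -
  have M0: "M \<ge> 0" using order.trans[OF norm_ge_zero M] .
  have "(\<lambda>j::int. M * K ^ k * (1 + \<bar>real_of_int j\<bar>) powr (-2)) summable_on UNIV"
    by (intro summable_on_cmult_right summable_on_int_powr) auto
  thus ?thesis
  proof (rule summable_on_comparison_test)
    fix j :: int
    show "norm (h j * (1 / g j ^ k)) \<le> M * K ^ k * (1 + \<bar>real_of_int j\<bar>) powr (-2)"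
    proof (cases "h j = 0")
      case True
      thus ?thesis using M0 K by simp
    next
      case False
      define N where "N = norm (g j)"
      have N: "1 + \<bar>real_of_int j\<bar> \<le> K * N" using ge[OF False] by (simp add: N_def)
      have "0 < K * N" using N by linarith
      hence Npos: "N > 0" using K by (simp add: zero_less_mult_iff)
      have "(1 + \<bar>real_of_int j\<bar>) ^ 2 \<le> (1 + \<bar>real_of_int j\<bar>) ^ k"
        using k by (intro power_increasing) auto
      also have "\<dots> \<le> (K * N) ^ k" using N by (intro power_mono) auto
      finally have "1 / (K * N) ^ k \<le> 1 / (1 + \<bar>real_of_int j\<bar>) ^ 2"
        by (intro divide_left_mono) (auto intro!: mult_pos_pos zero_less_power simp: K Npos)
      hence "K ^ k * (1 / (K * N) ^ k) \<le> K ^ k * (1 / (1 + \<bar>real_of_int j\<bar>) ^ 2)"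
        using K by (intro mult_left_mono) auto
      also have "K ^ k * (1 / (K * N) ^ k) = 1 / N ^ k"
        using K by (simp add: power_mult_distrib)
      also have "1 / (1 + \<bar>real_of_int j\<bar>) ^ 2 = (1 + \<bar>real_of_int j\<bar>) powr (-2)"
        by (simp add: powr_minus powr_numeral divide_simps)
      finally have "norm (h j) * (1 / N ^ k) \<le> M * (K ^ k * (1 + \<bar>real_of_int j\<bar>) powr (-2))"
        using M[of j] M0 Npos by (intro mult_mono) auto
      thus ?thesis
        by (simp add: norm_mult norm_divide norm_power N_def mult.assoc)
    qed
  qed auto
qed

lemma summable_on_inverse_power_int:
  assumes \<tau>: "\<tau> \<in> uhp" and k: "k \<ge> 2"
  shows "(\<lambda>d::int. norm (1 / (\<tau> + of_int d) ^ k)) summable_on UNIV"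
proof -
  obtain K where K: "K > 0"
    "\<And>A d :: int. A \<noteq> 0 \<Longrightarrow> 1 + \<bar>real_of_int A\<bar> + \<bar>real_of_int d\<bar> \<le> K * norm (of_int A * \<tau> + of_int d)"
    using norm_lattice_point_ge[OF \<tau>] by blast
  have "1 + \<bar>real_of_int d\<bar> \<le> K * norm (\<tau> + of_int d)" for d
    using K(2)[of 1 d] by simp
  from summable_on_weighted_inverse_power[OF k K(1) _ this, of "\<lambda>_. 1" 1] show ?thesis
    by simp
qed

section \<open>Cotangent expansion through Digamma and its derivatives\<close>

lemma uhp_not_Ints: "z \<in> uhp \<Longrightarrow> z \<notin> \<int>"
  by (auto simp: uhp_def Ints_def)

text \<open>Logarithmic derivative of the reflection formula:
  \<open>Gamma z * Gamma (1 - z) * sin (pi * z)\<close> is constant on the half plane.\<close>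

lemma Digamma_reflection:
  assumes z: "z \<in> uhp"
  shows "Digamma (1 - z) - Digamma z = of_real pi * cos (of_real pi * z) / sin (of_real pi * z)"
proof -
  let ?f = "\<lambda>z::complex. Gamma z * Gamma (1 - z) * sin (of_real pi * z)"
  have z': "z \<notin> \<int>" using uhp_not_Ints[OF z] .
  hence 1: "z \<notin> \<int>\<^sub>\<le>\<^sub>0" "1 - z \<notin> \<int>\<^sub>\<le>\<^sub>0"
    using nonpos_Ints_subset_Ints Ints_diff[of 1 "1 - z"] by auto
  have sin: "sin (of_real pi * w) \<noteq> 0" if "w \<in> uhp" for w
    using uhp_not_Ints[OF that] by (auto simp: sin_eq_0 mult_ac Ints_def)
  have "(?f has_field_derivative
          ?f z * (Digamma z - Digamma (1 - z)) + Gamma z * Gamma (1 - z) * (of_real pi * cos (of_real pi * z))) (at z)"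
    using 1 by (auto intro!: derivative_eq_intros simp: algebra_simps)
  moreover have "(?f has_field_derivative 0) (at z)"
    by (rule has_field_derivative_transform_within_open[of "\<lambda>_. of_real pi" _ _ uhp])
       (use z sin in \<open>auto simp: uhp_def open_halfspace_Im_gt Gamma_reflection_complex\<close>)
  ultimately have "?f z * (Digamma z - Digamma (1 - z)) + Gamma z * Gamma (1 - z) * (of_real pi * cos (of_real pi * z)) = 0"
    by (rule DERIV_unique)
  hence "Gamma z * Gamma (1 - z) * (sin (of_real pi * z) * (Digamma z - Digamma (1 - z)) + of_real pi * cos (of_real pi * z)) = 0"
    by (simp add: algebra_simps)
  moreover have "Gamma z * Gamma (1 - z) \<noteq> 0" using 1 by (simp add: Gamma_eq_zero_iff)
  ultimately have "sin (of_real pi * z) * (Digamma z - Digamma (1 - z)) + of_real pi * cos (of_real pi * z) = 0"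
    by simp
  thus ?thesis using sin[OF z] by (simp add: field_simps)
qed

text \<open>Termwise differentiation of the series for \<open>j\<close> has coefficients
  \<open>(n + 1) * (n + 2) ^ j\<close>, which dominate \<open>(n + 1) ^ (j + 1)\<close>.\<close>

lemma disc_summable_Suc_power: "disc_summable (\<lambda>n. of_nat (Suc n) ^ j)"
proof (induction j)
  case 0
  thus ?case by (auto simp: disc_summable_def intro: summable_geometric)
next
  case (Suc j)
  let ?c = "\<lambda>n. of_nat (Suc n) ^ j :: complex"
  show ?case unfolding disc_summable_def
  proof (intro allI impI)
    fix q :: complex assume q: "norm q < 1"
    have "summable (\<lambda>n. diffs ?c n * x ^ n)" if "norm x < 1" for x :: complex
      using Suc that by (intro termdiff_converges[of _ 1]) (auto simp: disc_summable_def)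
    hence S: "summable (\<lambda>n. norm (diffs ?c n * q ^ n))"
      using q by (intro powser_insidea[of _ "of_real ((norm q + 1) / 2)"]) auto
    show "summable (\<lambda>n. of_nat (Suc n) ^ Suc j * q ^ n)"
    proof (rule summable_comparison_test'[OF S, of 0])
      fix n :: nat
      have "real (Suc n) * real (Suc n) ^ j \<le> real (Suc n) * real (Suc (Suc n)) ^ j"
        by (intro mult_left_mono power_mono) auto
      thus "norm (of_nat (Suc n) ^ Suc j * q ^ n) \<le> norm (diffs ?c n * q ^ n)"
        unfolding diffs_def norm_mult norm_power norm_of_nat power_Suc
        by (intro mult_right_mono) auto
    qed
  qed
qed

lemma disc_summable_poly_bound:
  assumes "\<And>n. norm (c n) \<le> M * real (Suc n) ^ j"
  shows "disc_summable c"
  unfolding disc_summable_def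
proof (intro allI impI)
  fix q :: complex assume q: "norm q < 1"
  have "summable (\<lambda>n. norm (of_nat (Suc n) ^ j * q ^ n))"
    by (rule powser_insidea[of _ "of_real ((norm q + 1) / 2)"])
       (use q disc_summable_Suc_power[of j] in \<open>auto simp: disc_summable_def\<close>)
  hence S: "summable (\<lambda>n. M * norm (of_nat (Suc n) ^ j * q ^ n))"
    by (rule summable_mult)
  show "summable (\<lambda>n. c n * q ^ n)"
    by (rule summable_comparison_test'[OF S, of 0])
       (use mult_right_mono[OF assms norm_ge_zero[of "q ^ n" for n]] in
          \<open>simp add: norm_mult norm_power mult_ac del: of_nat_Suc\<close>)
qed

lemma summable_norm_qseries:
  assumes "disc_summable c" "z \<in> uhp"
  shows "summable (\<lambda>n. norm (c n * ee (of_nat (Suc n) * z)))"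
proof -
  have "summable (\<lambda>n. norm (c n * ee z ^ n))"
    by (rule powser_insidea[of _ "of_real ((norm (ee z) + 1) / 2)"])
       (use norm_ee_less_1[OF assms(2)] assms(1) in \<open>auto simp: disc_summable_def\<close>)
  from summable_mult[OF this, of "norm (ee z)"] show ?thesis
    unfolding ee_of_nat_mult by (simp add: norm_mult norm_power mult_ac)
qed

lemma qseries_cmult:
  assumes "disc_summable c" "z \<in> uhp"
  shows "qseries (\<lambda>n. a * c n) z = a * qseries c z"
  unfolding qseries_def mult.assoc
  by (rule suminf_mult, rule summable_norm_cancel, rule summable_norm_qseries[OF assms])

text \<open>The left side is \<open>pi * cot (pi * z)\<close>. With \<open>p * p = q\<close> the
  cotangent becomes \<open>\<i> * (q + 1) / (q - 1)\<close>, which is a constant plus a geometric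
  series.\<close>

lemma Digamma_diff_qseries:
  assumes z: "z \<in> uhp"
  shows "Digamma (1 - z) - Digamma z = - of_real pi * \<i> - 2 * of_real pi * \<i> * qseries (\<lambda>_. 1) z"
proof -
  define q where "q = ee z"
  define p where "p = exp (\<i> * (of_real pi * z))"
  have q: "norm q < 1" using norm_ee_less_1[OF z] by (simp add: q_def)
  hence q1: "q \<noteq> 1" by auto
  have p: "p * p = q" "p \<noteq> 0"
    unfolding p_def q_def ee_def by (auto simp: exp_add[symmetric] mult_ac)
  have ds: "disc_summable (\<lambda>_. 1)" using disc_summable_Suc_power[of 0] by simp
  have 1: "qseries (\<lambda>_. 1) z = q / (1 - q)"
    by (subst qseries_altdef[OF ds z]) (use q in \<open>simp add: q_def[symmetric] suminf_geometric\<close>)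
  have c: "cos (of_real pi * z) = (p + inverse p) / 2" "sin (of_real pi * z) = (p - inverse p) / (2 * \<i>)"
    by (simp_all add: cos_exp_eq sin_exp_eq p_def exp_minus)
  have "p - inverse p \<noteq> 0" using p q1 by (auto simp: field_simps)
  hence "of_real pi * cos (of_real pi * z) / sin (of_real pi * z) = of_real pi * \<i> * ((p + inverse p) / (p - inverse p))"
    unfolding c by (simp add: divide_simps)
  also have "(p + inverse p) / (p - inverse p) = (p * (p + inverse p)) / (p * (p - inverse p))"
    using p by simp
  also have "\<dots> = (q + 1) / (q - 1)" using p by (simp add: algebra_simps)
  also have "of_real pi * \<i> * ((q + 1) / (q - 1)) =
      - of_real pi * \<i> - 2 * of_real pi * \<i> * (q / (1 - q))"
    using q1 by (simp add: divide_simps) (simp add: algebra_simps)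
  finally show ?thesis
    unfolding 1 by (simp add: Digamma_reflection[OF z])
qed

text \<open>Obtained by differentiating \<open>n\<close> times: each derivative brings out
  \<open>2 * pi * \<i> * Suc m\<close> and changes the sign at \<open>1 - z\<close>; the constant is
  gone after the first.\<close>

lemma Polygamma_diff_qseries:
  assumes z: "z \<in> uhp"
  shows "(- 1) ^ n * Polygamma n (1 - z) - Polygamma n z =
           - (if n = 0 then of_real pi * \<i> else 0)
             - (2 * of_real pi * \<i>) ^ Suc n * qseries (\<lambda>m. of_nat (Suc m) ^ n) z"
  using z
proof (induction n arbitrary: z)
  case 0
  thus ?case using Digamma_diff_qseries[of z] by simp
next
  case (Suc n)
  let ?c = "\<lambda>m. 2 * of_real pi * \<i> * of_nat (Suc m) ^ Suc n"
  have ds: "disc_summable ?c"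
    by (rule disc_summable_poly_bound[of _ "2 * pi" "Suc n"])
       (simp add: norm_mult norm_power del: of_nat_Suc power_Suc)
  have "anti_coeff ?c = (\<lambda>m. of_nat (Suc m) ^ n)"
    by (auto simp: anti_coeff_def simp del: of_nat_Suc)
  with has_field_derivative_qseries_anti[OF ds Suc.prems]
  have D: "(qseries (\<lambda>m. of_nat (Suc m) ^ n) has_field_derivative qseries ?c z) (at z)"
    by simp
  have q: "qseries ?c z = 2 * of_real pi * \<i> * qseries (\<lambda>m. of_nat (Suc m) ^ Suc n) z"
    by (rule qseries_cmult[OF disc_summable_Suc_power Suc.prems])
  have 1: "((\<lambda>z. - (if n = 0 then of_real pi * \<i> else 0)
             - (2 * of_real pi * \<i>) ^ Suc n * qseries (\<lambda>m. of_nat (Suc m) ^ n) z)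
        has_field_derivative 0 - (2 * of_real pi * \<i>) ^ Suc n * qseries ?c z) (at z)"
    by (intro DERIV_diff DERIV_const DERIV_cmult D)
  have nz: "z \<notin> \<int>\<^sub>\<le>\<^sub>0" "1 - z \<notin> \<int>\<^sub>\<le>\<^sub>0"
    using uhp_not_Ints[OF Suc.prems] nonpos_Ints_subset_Ints Ints_diff[of 1 "1 - z"] by auto
  have "((\<lambda>z. (- 1) ^ n * Polygamma n (1 - z) - Polygamma n z) has_field_derivative
         (- 1) ^ n * (Polygamma (Suc n) (1 - z) * (0 - 1)) - Polygamma (Suc n) z) (at z)"
    by (intro DERIV_diff DERIV_cmult DERIV_chain2[OF has_field_derivative_Polygamma]
         has_field_derivative_Polygamma nz DERIV_const DERIV_ident)
  hence "((\<lambda>z. - (if n = 0 then of_real pi * \<i> else 0)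
             - (2 * of_real pi * \<i>) ^ Suc n * qseries (\<lambda>m. of_nat (Suc m) ^ n) z)
         has_field_derivative
         (- 1) ^ n * (Polygamma (Suc n) (1 - z) * (0 - 1)) - Polygamma (Suc n) z) (at z)"
    by (rule has_field_derivative_transform_within_open[of _ _ _ uhp])
       (use Suc in \<open>auto simp: uhp_def open_halfspace_Im_gt\<close>)
  from DERIV_unique[OF this 1] show ?case
    unfolding q by (simp add: mult_ac)
qed

definition lipschitz_const :: "nat \<Rightarrow> complex" where
  "lipschitz_const k = (- 2 * of_real pi * \<i>) ^ k / fact (k - 1)"

lemma lipschitz_const_nonzero: "lipschitz_const k \<noteq> 0"
  by (simp add: lipschitz_const_def)

lemma Lipschitz_formula:
  assumes z: "z \<in> uhp" and k: "k \<ge> 2"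
  shows "((\<lambda>d::int. 1 / (z + of_int d) ^ k) has_sum
           lipschitz_const k * qseries (\<lambda>m. of_nat (Suc m) ^ (k - 1)) z) UNIV"
proof -
  define n where "n = k - 1"
  have n: "k = Suc n" "n > 0" using k by (auto simp: n_def)
  let ?f = "\<lambda>d::int. 1 / (z + of_int d) ^ k"
  have S: "(\<lambda>d. norm (?f d)) summable_on UNIV"
    by (rule summable_on_inverse_power_int[OF z k])
  have zn: "z \<noteq> 0" "1 - z \<noteq> 0" using z by (auto simp: uhp_def)
  have half: "((\<lambda>m. ?f (h m)) has_sum x) UNIV" if "inj h" "(\<lambda>m. ?f (h m)) sums x" for h :: "nat \<Rightarrow> int" and x
  proof -
    have "(\<lambda>d. norm (?f d)) summable_on range h"
      by (rule summable_on_subset[OF S]) auto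
    hence "(\<lambda>m. norm (?f (h m))) summable_on UNIV"
      using that(1) by (subst (asm) summable_on_reindex) (auto simp: o_def)
    hence "summable (\<lambda>m. norm (?f (h m)))" by (rule summable_on_imp_summable)
    thus ?thesis using that(2) by (rule norm_summable_imp_has_sum)
  qed
  have 1: "(\<lambda>m. ?f (int m)) sums ((- 1) ^ k * Polygamma n z / fact n)"
    using Polygamma_LIMSEQ[OF zn(1) n(2)] by (simp add: n inverse_eq_divide)
  \<comment> \<open>The negative \<open>d\<close> are the numbers \<open>- 1 - m\<close>; up to the
    sign \<open>(- 1) ^ k\<close> they form the Polygamma series at \<open>1 - z\<close>.\<close>
  have "1 - z + of_nat m = - (z + of_int (- 1 - int m))" for m by simp
  hence e: "inverse ((1 - z + of_nat m) ^ k) = (- 1) ^ k * ?f (- 1 - int m)" for m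
    by (metis divide_inverse mult_1 power_minus inverse_mult_distrib power_inverse inverse_minus_eq inverse_1)
  have "(\<lambda>m. (- 1) ^ k * ?f (- 1 - int m)) sums ((- 1) ^ k * Polygamma n (1 - z) / fact n)"
    using Polygamma_LIMSEQ[OF zn(2) n(2)] unfolding n(1)[symmetric] e .
  from sums_mult[OF this, of "(-1)^k"]
  have 2: "(\<lambda>m. ?f (- 1 - int m)) sums (Polygamma n (1 - z) / fact n)"
    by (simp add: mult.assoc[symmetric] power_mult_distrib[symmetric])
  have "(?f has_sum ((- 1) ^ k * Polygamma n z / fact n + Polygamma n (1 - z) / fact n)) UNIV"
    by (intro has_sum_int_halves half 1 2) (auto simp: inj_on_def)
  also have "(- 1) ^ k * Polygamma n z / fact n + Polygamma n (1 - z) / fact n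
      = (- 1) ^ n * ((- 1) ^ n * Polygamma n (1 - z) - Polygamma n z) / fact n"
    by (simp add: n field_simps power_mult_distrib[symmetric])
  also have "\<dots> = lipschitz_const k * qseries (\<lambda>m. of_nat (Suc m) ^ (k - 1)) z"
    unfolding Polygamma_diff_qseries[OF z]
    using n by (simp add: lipschitz_const_def power_minus[of "\<i> * (of_real pi * 2)"] mult_ac)
  finally show ?thesis .
qed

subsection \<open>Modularity of lattice sums\<close>

lemma has_sum_int_translate:
  fixes a :: "int \<Rightarrow> complex"
  assumes "(a has_sum s) UNIV"
  shows "((\<lambda>d. a (d + t)) has_sum s) UNIV"
proof -
  have "bij_betw (\<lambda>d::int. d + t) UNIV UNIV"
    by (rule bij_betwI[of _ _ _ "\<lambda>d. d - t"]) auto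
  from has_sum_reindex_bij_betw[OF this, of a s] assms show ?thesis by simp
qed

text \<open>Translation by a period of \<open>h\<close> does not change the sum, so the halves
  cancel. They may be separated because one half alone converges absolutely.\<close>

lemma has_sum_shift_difference:
  fixes h \<phi> :: "int \<Rightarrow> complex"
  assumes "(\<lambda>j. norm (h j * \<phi> j)) summable_on UNIV" and "\<And>j. h (j + t) = h j"
  shows "((\<lambda>j. h j * (\<phi> j - \<phi> (j + t))) has_sum 0) UNIV"
proof -
  obtain s where s: "((\<lambda>j. h j * \<phi> j) has_sum s) UNIV"
    using abs_summable_summable[OF assms(1)] by (auto simp: summable_on_def)
  from has_sum_int_translate[OF this, of t]
  have "((\<lambda>j. h j * \<phi> (j + t)) has_sum s) UNIV" by (simp add: assms(2))
  from has_sum_add[OF s has_sum_uminusI[OF this]] show ?thesis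
    by (simp add: algebra_simps)
qed

text \<open>The base dominates both \<open>1 + abs A\<close> and \<open>1 + abs d\<close>, so the
  exponent 3 can be shared as \<open>3 / 2\<close> for each, still above 1.\<close>

lemma summable_on_int_cube:
  "(\<lambda>(A, d). 1 / (1 + \<bar>real_of_int A\<bar> + \<bar>real_of_int d\<bar>) ^ 3) summable_on UNIV"
proof -
  let ?g = "\<lambda>n::int. (1 + \<bar>real_of_int n\<bar>) powr (- 3 / 2)"
  obtain S where S: "(?g has_sum S) UNIV"
    using summable_on_int_powr[of "- 3 / 2"] by (auto simp: summable_on_def)
  have "(\<lambda>(A, d). ?g A * ?g d) summable_on (UNIV \<times> UNIV)"
  proof (rule summable_on_SigmaI[where g = "\<lambda>A. ?g A * S"])
    show "((\<lambda>d. case (A, d) of (A, d) \<Rightarrow> ?g A * ?g d) has_sum ?g A * S) UNIV" for A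
      using has_sum_cmult_right[OF S] by simp
    show "(\<lambda>A. ?g A * S) summable_on UNIV"
      by (intro summable_on_cmult_left summable_on_int_powr) auto
  qed auto
  hence "(\<lambda>(A, d). ?g A * ?g d) summable_on UNIV" by simp
  thus ?thesis
  proof (rule summable_on_comparison_test, goal_cases)
    case (1 x)
    obtain A d where x: "x = (A, d)" by (cases x)
    define n where "n = 1 + \<bar>real_of_int A\<bar> + \<bar>real_of_int d\<bar>"
    have n: "n > 0" by (simp add: n_def add_pos_nonneg)
    have "1 / n ^ 3 = n powr (- 3 / 2) * n powr (- 3 / 2)"
      using n by (simp add: powr_add[symmetric] powr_minus powr_numeral divide_simps)
    also have "\<dots> \<le> ?g A * ?g d"
      by (intro mult_mono powr_mono2') (auto simp: n_def)
    finally show ?case by (simp add: x n_def)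
  qed auto
qed

text \<open>Scaling by \<open>r\<close> moves the reciprocals into the closed unit disc, where
  \<open>k\<close>-th powers are Lipschitz with constant \<open>k\<close>. A difference thereby
  gains one order over a single term.\<close>

lemma norm_inverse_power_diff_le:
  fixes x y :: complex
  assumes r: "r > 0" "r \<le> norm x" "r \<le> norm y"
  shows "norm (1 / x ^ k - 1 / y ^ k) \<le> real k * norm (x - y) / r ^ (k + 1)"
proof -
  define u v where "u = of_real r / x" and "v = of_real r / y"
  have nz: "x \<noteq> 0" "y \<noteq> 0" using r by auto
  have uv: "norm u \<le> 1" "norm v \<le> 1"
    using r nz by (auto simp: u_def v_def norm_divide divide_le_eq)
  have "u - v = of_real r * (y - x) / (x * y)"
    using nz by (simp add: u_def v_def field_simps)
  hence "norm (u - v) = r * norm (x - y) / (norm x * norm y)"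
    using r by (simp add: norm_mult norm_divide norm_minus_commute)
  also have "\<dots> \<le> r * norm (x - y) / (r * r)"
    using r nz by (intro divide_left_mono mult_mono) (auto intro!: mult_pos_pos)
  finally have "norm (u - v) \<le> norm (x - y) / r" using r by (simp add: field_simps)
  hence "norm (u ^ k - v ^ k) \<le> real k * (norm (x - y) / r)"
    using norm_power_diff[OF uv, of k] by (meson mult_left_mono of_nat_0_le_iff order.trans)
  moreover have "1 / x ^ k - 1 / y ^ k = (u ^ k - v ^ k) / of_real r ^ k"
    using r by (simp add: u_def v_def power_divide diff_divide_distrib)
  ultimately have "norm (1 / x ^ k - 1 / y ^ k) \<le> real k * (norm (x - y) / r) / r ^ k"
    using r by (simp only: norm_divide norm_power norm_of_real abs_of_pos)
      (rule divide_right_mono, assumption, simp)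
  thus ?thesis using r by (simp add: field_simps)
qed

lemma norm_shifted_lattice_point_ge:
  assumes "\<tau> \<in> uhp"
  obtains K where "K > 0"
    "\<And>A d :: int. A + \<mu> \<noteq> 0 \<Longrightarrow>
       1 + \<bar>real_of_int A\<bar> + \<bar>real_of_int d\<bar> \<le> K * norm (of_int (A + \<mu>) * \<tau> + of_int (d + \<nu>))"
proof -
  obtain K where K: "K > 0"
    "\<And>A d :: int. A \<noteq> 0 \<Longrightarrow> 1 + \<bar>real_of_int A\<bar> + \<bar>real_of_int d\<bar> \<le> K * norm (of_int A * \<tau> + of_int d)"
    using norm_lattice_point_ge[OF assms] by blast
  \<comment> \<open>The shift changes the size by at most \<open>L - 1\<close>; as
    \<open>n \<ge> 1\<close>, this additive loss becomes the factor \<open>L\<close>.\<close>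
  define L where "L = 1 + \<bar>real_of_int \<mu>\<bar> + \<bar>real_of_int \<nu>\<bar>"
  have L: "L > 0" by (simp add: L_def add_pos_nonneg)
  show ?thesis
  proof (rule that[of "L * K"])
    show "L * K > 0" using K L by simp
    fix A d :: int assume A: "A + \<mu> \<noteq> 0"
    define n where "n = 1 + \<bar>real_of_int (A + \<mu>)\<bar> + \<bar>real_of_int (d + \<nu>)\<bar>"
    have "\<bar>real_of_int A\<bar> \<le> \<bar>real_of_int (A + \<mu>)\<bar> + \<bar>real_of_int \<mu>\<bar>" by linarith
    moreover have "\<bar>real_of_int d\<bar> \<le> \<bar>real_of_int (d + \<nu>)\<bar> + \<bar>real_of_int \<nu>\<bar>" by linarith
    ultimately have "1 + \<bar>real_of_int A\<bar> + \<bar>real_of_int d\<bar> \<le> n + (L - 1) * 1"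
      by (simp add: n_def L_def)
    also have "\<dots> \<le> n + (L - 1) * n"
      by (intro add_left_mono mult_left_mono) (auto simp: n_def L_def)
    also have "\<dots> = L * n" by (simp add: algebra_simps)
    also have "\<dots> \<le> L * (K * norm (of_int (A + \<mu>) * \<tau> + of_int (d + \<nu>)))"
      using K(2)[OF A, of "d + \<nu>"] L unfolding n_def by (intro mult_left_mono) auto
    finally show "1 + \<bar>real_of_int A\<bar> + \<bar>real_of_int d\<bar>
        \<le> L * K * norm (of_int (A + \<mu>) * \<tau> + of_int (d + \<nu>))" by (simp add: mult.assoc)
  qed
qed

section \<open>Periodic functions on the integers\<close>

lemma periodic_dvd:
  fixes f :: "int \<Rightarrow> complex"
  assumes per: "\<And>n. f (n + int p) = f n" and "int p dvd m"
  shows "f (n + m) = f n"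
proof -
  obtain t where t: "m = int p * t" using assms(2) by blast
  have nat: "f (n + int p * int i) = f n" for n i
  proof (induction i)
    case (Suc i)
    have *: "n + int p * int (Suc i) = n + int p * int i + int p" by (simp add: algebra_simps)
    show ?case unfolding * per by (rule Suc.IH)
  qed auto
  show ?thesis
  proof (cases "t \<ge> 0")
    case True
    thus ?thesis using nat[of n "nat t"] by (simp add: t)
  next
    case False
    thus ?thesis using nat[of "n + int p * t" "nat (- t)"] by (simp add: t)
  qed
qed

lemma periodic_mod:
  fixes f :: "int \<Rightarrow> complex"
  assumes per: "\<And>n. f (n + int p) = f n"
  shows "f (n mod int p) = f n"
  using periodic_dvd[of f p, OF per, of "- (int p * (n div int p))" n]
  by (simp add: minus_mult_div_eq_mod)

lemma periodic_bounded:
  fixes f :: "int \<Rightarrow> complex"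
  assumes per: "\<And>n. f (n + int p) = f n" and p: "p > 0"
  obtains M where "M \<ge> 0" "\<And>n. norm (f n) \<le> M"
proof (rule that)
  show "(\<Sum>i\<in>{0..<int p}. norm (f i)) \<ge> 0" by (intro sum_nonneg) auto
  fix n
  have "norm (f (n mod int p)) \<le> (\<Sum>i\<in>{0..<int p}. norm (f i))"
    using p by (intro member_le_sum) auto
  thus "norm (f n) \<le> (\<Sum>i\<in>{0..<int p}. norm (f i))"
    by (simp add: periodic_mod[of f p, OF per])
qed

definition lattice_diff :: "nat \<Rightarrow> complex \<Rightarrow> int \<times> int \<Rightarrow> int \<times> int \<Rightarrow> int \<times> int \<Rightarrow> complex" where
  "lattice_diff k \<tau> \<mu> \<nu> w =
     1 / (of_int (fst w + fst \<mu>) * \<tau> + of_int (snd w + snd \<mu>)) ^ k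
     - 1 / (of_int (fst w + fst \<nu>) * \<tau> + of_int (snd w + snd \<nu>)) ^ k"

text \<open>For \<open>k = 2\<close> the lattice sum of \<open>(A \<tau> + d) ^ (-k)\<close> is not absolutely convergent, but the
  differences of two translates are summable of order \<open>k + 1\<close>. The condition \<open>f 0 = 0\<close> removes
  the pole at the origin of the lattice.\<close>
locale periodic_pair =
  fixes f G :: "int \<Rightarrow> complex" and p q k :: nat
  assumes p: "p > 0" and q: "q > 0" and k: "k \<ge> 2"
    and f_periodic: "\<And>n. f (n + int p) = f n"
    and G_periodic: "\<And>n. G (n + int q) = G n"
    and f_0: "f 0 = 0"
begin

definition wt :: "int \<times> int \<Rightarrow> complex" where
  "wt w = f (fst w) * G (snd w)"

text \<open>By periodicity \<open>f (A + m) = f A\<close>, which differs from \<open>f 0\<close>. So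
  a point of nonzero weight is never translated into row 0, where the pole lies.\<close>

lemma nonzero_shift: "f A \<noteq> 0 \<Longrightarrow> int p dvd m \<Longrightarrow> A + m \<noteq> 0"
  using periodic_dvd[of f p m A, OF f_periodic] f_0 by metis

lemma summable_lattice_diff:
  assumes \<tau>: "\<tau> \<in> uhp" and dvd: "int p dvd fst \<mu>" "int p dvd fst \<nu>"
  shows "(\<lambda>w. norm (wt w * lattice_diff k \<tau> \<mu> \<nu> w)) summable_on UNIV"
proof -
  obtain M1 where M1: "M1 \<ge> 0" "\<And>n. norm (f n) \<le> M1"
    using periodic_bounded[of f p, OF f_periodic p] by blast
  obtain M2 where M2: "M2 \<ge> 0" "\<And>n. norm (G n) \<le> M2"
    using periodic_bounded[of G q, OF G_periodic q] by blast
  obtain K1 where K1: "K1 > 0" "\<And>A d :: int. A + fst \<mu> \<noteq> 0 \<Longrightarrow>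
       1 + \<bar>real_of_int A\<bar> + \<bar>real_of_int d\<bar> \<le> K1 * norm (of_int (A + fst \<mu>) * \<tau> + of_int (d + snd \<mu>))"
    using norm_shifted_lattice_point_ge[OF \<tau>] by blast
  obtain K2 where K2: "K2 > 0" "\<And>A d :: int. A + fst \<nu> \<noteq> 0 \<Longrightarrow>
       1 + \<bar>real_of_int A\<bar> + \<bar>real_of_int d\<bar> \<le> K2 * norm (of_int (A + fst \<nu>) * \<tau> + of_int (d + snd \<nu>))"
    using norm_shifted_lattice_point_ge[OF \<tau>] by blast
  define K where "K = max K1 K2"
  have K: "K > 0" using K1 by (simp add: K_def)
  \<comment> \<open>The two translates of a lattice point differ by a vector independent of the
    point. This gives decay of order \<open>k + 1\<close>, at least 3.\<close>
  define D where "D = norm (of_int (fst \<mu> - fst \<nu>) * \<tau> + of_int (snd \<mu> - snd \<nu>))"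
  define C where "C = M1 * M2 * (real k * D * K ^ (k + 1))"
  have "(\<lambda>w. C * (case w of (A, d) \<Rightarrow> 1 / (1 + \<bar>real_of_int A\<bar> + \<bar>real_of_int d\<bar>) ^ 3)) summable_on UNIV"
    by (intro summable_on_cmult_right summable_on_int_cube)
  thus ?thesis
  proof (rule summable_on_comparison_test)
    fix w :: "int \<times> int"
    obtain A d where w: "w = (A, d)" by (cases w)
    define n where "n = 1 + \<bar>real_of_int A\<bar> + \<bar>real_of_int d\<bar>"
    have n: "n \<ge> 1" by (simp add: n_def)
    have "norm (wt w * lattice_diff k \<tau> \<mu> \<nu> w) \<le> C * (1 / n ^ 3)"
    proof (cases "f A = 0")
      case True
      thus ?thesis using M1 M2 K n by (simp add: wt_def w C_def D_def)
    next
      case False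
      define x where "x = of_int (A + fst \<mu>) * \<tau> + of_int (d + snd \<mu>)"
      define y where "y = of_int (A + fst \<nu>) * \<tau> + of_int (d + snd \<nu>)"
      have "n \<le> K1 * norm x"
        using K1(2)[OF nonzero_shift[OF False dvd(1)], of d] by (simp add: n_def x_def)
      also have "\<dots> \<le> K * norm x" by (intro mult_right_mono) (auto simp: K_def)
      finally have x: "n / K \<le> norm x" using K by (simp add: field_simps)
      have "n \<le> K2 * norm y"
        using K2(2)[OF nonzero_shift[OF False dvd(2)], of d] by (simp add: n_def y_def)
      also have "\<dots> \<le> K * norm y" by (intro mult_right_mono) (auto simp: K_def)
      finally have y: "n / K \<le> norm y" using K by (simp add: field_simps)
      have xy: "norm (x - y) = D"
        unfolding x_def y_def D_def by (rule arg_cong[of _ _ norm]) (simp add: algebra_simps)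
      have "norm (1 / x ^ k - 1 / y ^ k) \<le> real k * norm (x - y) / (n / K) ^ (k + 1)"
        using K n x y by (intro norm_inverse_power_diff_le) auto
      also have "\<dots> = real k * D * K ^ (k + 1) * (1 / n ^ (k + 1))"
        using K n by (simp add: xy power_divide field_simps)
      also have "\<dots> \<le> real k * D * K ^ (k + 1) * (1 / n ^ 3)"
        using K n k by (intro mult_left_mono divide_left_mono power_increasing) (auto simp: D_def)
      finally have "norm (lattice_diff k \<tau> \<mu> \<nu> w) \<le> real k * D * K ^ (k + 1) * (1 / n ^ 3)"
        by (simp add: lattice_diff_def w x_def y_def)
      hence "norm (f A) * norm (G d) * norm (lattice_diff k \<tau> \<mu> \<nu> w)
              \<le> M1 * M2 * (real k * D * K ^ (k + 1) * (1 / n ^ 3))"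
        using M1 M2 by (intro mult_mono) auto
      thus ?thesis by (simp add: wt_def w norm_mult C_def mult_ac)
    qed
    thus "norm (wt w * lattice_diff k \<tau> \<mu> \<nu> w)
            \<le> C * (case w of (A, d) \<Rightarrow> 1 / (1 + \<bar>real_of_int A\<bar> + \<bar>real_of_int d\<bar>) ^ 3)"
      by (simp add: w n_def)
  qed auto
qed

lemma summable_row:
  assumes \<tau>: "\<tau> \<in> uhp" and "int p dvd m"
  shows "(\<lambda>d. norm (f A * G d * (1 / (of_int (A + m) * \<tau> + of_int (d + n)) ^ k))) summable_on UNIV"
proof -
  obtain M1 where M1: "M1 \<ge> 0" "\<And>n. norm (f n) \<le> M1"
    using periodic_bounded[of f p, OF f_periodic p] by blast
  obtain M2 where M2: "M2 \<ge> 0" "\<And>n. norm (G n) \<le> M2"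
    using periodic_bounded[of G q, OF G_periodic q] by blast
  obtain K where K: "K > 0" "\<And>A d :: int. A + m \<noteq> 0 \<Longrightarrow>
       1 + \<bar>real_of_int A\<bar> + \<bar>real_of_int d\<bar> \<le> K * norm (of_int (A + m) * \<tau> + of_int (d + n))"
    using norm_shifted_lattice_point_ge[OF \<tau>] by blast
  show ?thesis
  proof (rule summable_on_weighted_inverse_power[OF k K(1)])
    show "norm (f A * G d) \<le> M1 * M2" for d
      unfolding norm_mult using M1 M2 by (intro mult_mono) auto
    show "1 + \<bar>real_of_int d\<bar> \<le> K * norm (of_int (A + m) * \<tau> + of_int (d + n))" if "f A * G d \<noteq> 0" for d
      using K(2)[OF nonzero_shift[OF _ assms(2)], of A d] that by auto
  qed
qed

lemma summable_column:
  assumes \<tau>: "\<tau> \<in> uhp" and "int p dvd m"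
  shows "(\<lambda>A. norm (f A * G d * (1 / (of_int (A + m) * \<tau> + of_int (d + n)) ^ k))) summable_on UNIV"
proof -
  obtain M1 where M1: "M1 \<ge> 0" "\<And>n. norm (f n) \<le> M1"
    using periodic_bounded[of f p, OF f_periodic p] by blast
  obtain M2 where M2: "M2 \<ge> 0" "\<And>n. norm (G n) \<le> M2"
    using periodic_bounded[of G q, OF G_periodic q] by blast
  obtain K where K: "K > 0" "\<And>A d :: int. A + m \<noteq> 0 \<Longrightarrow>
       1 + \<bar>real_of_int A\<bar> + \<bar>real_of_int d\<bar> \<le> K * norm (of_int (A + m) * \<tau> + of_int (d + n))"
    using norm_shifted_lattice_point_ge[OF \<tau>] by blast
  show ?thesis
  proof (rule summable_on_weighted_inverse_power[OF k K(1)])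
    show "norm (f A * G d) \<le> M1 * M2" for A
      unfolding norm_mult using M1 M2 by (intro mult_mono) auto
    show "1 + \<bar>real_of_int A\<bar> \<le> K * norm (of_int (A + m) * \<tau> + of_int (d + n))" if "f A * G d \<noteq> 0" for A
      using K(2)[OF nonzero_shift[OF _ assms(2)], of A d] that by auto
  qed
qed

text \<open>Summing over \<open>d\<close> first, each row converges absolutely and is invariant
  under a shift by a period of \<open>G\<close>; absolute summability of the double series lifts
  this to the total.\<close>

lemma has_sum_column_shift:
  assumes \<tau>: "\<tau> \<in> uhp" and "int p dvd m" "int q dvd n' - n"
  shows "((\<lambda>w. wt w * lattice_diff k \<tau> (m, n) (m, n') w) has_sum 0) UNIV"
proof -
  let ?F = "\<lambda>w. wt w * lattice_diff k \<tau> (m, n) (m, n') w"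
  have "?F summable_on UNIV"
    by (rule abs_summable_summable[OF summable_lattice_diff]) (use assms in auto)
  then obtain S where S: "(?F has_sum S) UNIV" by (auto simp: summable_on_def)
  have row: "((\<lambda>d. ?F (A, d)) has_sum 0) UNIV" for A
  proof -
    have "((\<lambda>d. f A * G d * (1 / (of_int (A + m) * \<tau> + of_int (d + n)) ^ k -
             1 / (of_int (A + m) * \<tau> + of_int (d + (n' - n) + n)) ^ k)) has_sum 0) UNIV"
      by (rule has_sum_shift_difference[OF summable_row])
         (use assms periodic_dvd[of G q "n' - n", OF G_periodic] in auto)
    thus ?thesis by (simp add: wt_def lattice_diff_def)
  qed
  have "((\<lambda>_. 0) has_sum S) (UNIV :: int set)"
    by (rule has_sum_Sigma'[where f = ?F and B = "\<lambda>_. UNIV"]) (use S row in auto)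
  hence "S = 0" by (rule has_sum_unique[OF _ has_sum_0]) simp
  thus ?thesis using S by simp
qed

text \<open>The opposite order of summation: for fixed \<open>d\<close> the shift acts on
  \<open>A\<close> by a period of \<open>f\<close>.\<close>

lemma has_sum_row_shift:
  assumes \<tau>: "\<tau> \<in> uhp" and "int p dvd m" "int p dvd m'"
  shows "((\<lambda>w. wt w * lattice_diff k \<tau> (m, n) (m', n) w) has_sum 0) UNIV"
proof -
  let ?F = "\<lambda>w. wt w * lattice_diff k \<tau> (m, n) (m', n) w"
  have "?F summable_on UNIV"
    by (rule abs_summable_summable[OF summable_lattice_diff]) (use assms in auto)
  then obtain S where S: "(?F has_sum S) UNIV" by (auto simp: summable_on_def)
  have column: "((\<lambda>A. ?F (A, d)) has_sum 0) UNIV" for d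
  proof -
    have "((\<lambda>A. f A * G d * (1 / (of_int (A + m) * \<tau> + of_int (d + n)) ^ k -
             1 / (of_int (A + (m' - m) + m) * \<tau> + of_int (d + n)) ^ k)) has_sum 0) UNIV"
      by (rule has_sum_shift_difference[OF summable_column])
         (use assms periodic_dvd[of f p "m' - m", OF f_periodic] in auto)
    thus ?thesis by (simp add: wt_def lattice_diff_def)
  qed
  have "((\<lambda>(d, A). ?F (A, d)) has_sum S) (UNIV \<times> UNIV)"
    using S has_sum_swap[where f = ?F and S = S and A = UNIV and B = UNIV] by simp
  hence "((\<lambda>_. 0) has_sum S) (UNIV :: int set)"
    by (rule has_sum_Sigma'[where f = "\<lambda>(d, A). ?F (A, d)" and B = "\<lambda>_. UNIV"]) (use column in auto)
  hence "S = 0" by (rule has_sum_unique[OF _ has_sum_0]) simp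
  thus ?thesis using S by simp
qed

text \<open>Summation by parts in each row turns the step \<open>(0, 1)\<close> into the weight
  \<open>f A * (G d - G (d - 1))\<close> on \<open>1 / (A \<tau> + d) ^ k\<close>. So this is an
  Eisenstein lattice sum in a form that also converges absolutely for \<open>k = 2\<close>.\<close>

definition lattice_sum :: "complex \<Rightarrow> complex" where
  "lattice_sum \<tau> = (\<Sum>\<^sub>\<infinity>w. wt w * lattice_diff k \<tau> (0, 0) (0, 1) w)"

lemma has_sum_lattice_sum:
  assumes "\<tau> \<in> uhp"
  shows "((\<lambda>w. wt w * lattice_diff k \<tau> (0, 0) (0, 1) w) has_sum lattice_sum \<tau>) UNIV"
  unfolding lattice_sum_def
  by (intro has_sum_infsum abs_summable_summable[OF summable_lattice_diff]) (use assms in auto)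

text \<open>Reindexing by the matrix turns the shift by \<open>(0, 1)\<close> into the shift by \<open>(c, d)\<close>; the two differ
  by a period, and shifts by periods contribute 0.\<close>
lemma lattice_sum_modular:
  fixes a b c d :: int
  assumes \<tau>: "\<tau> \<in> uhp" and det: "a * d - b * c = 1"
    and cong: "int p dvd a - 1" "int q dvd b" "int p dvd c" "int q dvd d - 1"
    and \<tau>': "(of_int a * \<tau> + of_int b) / (of_int c * \<tau> + of_int d) \<in> uhp" (is "?\<tau>' \<in> _")
    and nz: "of_int c * \<tau> + of_int d \<noteq> 0"
  shows "lattice_sum ?\<tau>' = (of_int c * \<tau> + of_int d) ^ k * lattice_sum \<tau>"
proof -
  define j where "j = of_int c * \<tau> + of_int d"
  \<comment> \<open>Row vectors times the matrix; adding \<open>(0, 1)\<close> before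
    \<open>h\<close> amounts to adding \<open>(c, d)\<close> after it.\<close>
  define h where "h w = (fst w * a + snd w * c, fst w * b + snd w * d)" for w
  \<comment> \<open>From \<open>(0, 1)\<close> to \<open>(c, d)\<close> by way of
    \<open>(c, 1)\<close>: the first leg changes the first coordinate by a multiple of
    \<open>p\<close>, the second leg the second coordinate by a multiple of
    \<open>q\<close>.\<close>
  have "((\<lambda>w. wt w * lattice_diff k \<tau> (0, 0) (0, 1) w + wt w * lattice_diff k \<tau> (0, 1) (c, 1) w
           + wt w * lattice_diff k \<tau> (c, 1) (c, d) w) has_sum lattice_sum \<tau> + 0 + 0) UNIV"
    by (intro has_sum_add has_sum_lattice_sum has_sum_row_shift has_sum_column_shift \<tau>)
       (use cong in auto)
  hence 1: "((\<lambda>w. wt w * lattice_diff k \<tau> (0, 0) (c, d) w) has_sum lattice_sum \<tau>) UNIV"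
    by (simp add: distrib_left[symmetric]) (simp add: lattice_diff_def)
  have bij: "bij_betw h UNIV UNIV"
  proof (rule bij_betwI[of _ _ _ "\<lambda>w. (fst w * d - snd w * c, snd w * a - fst w * b)"])
    have "(fst w * a + snd w * c) * d - (fst w * b + snd w * d) * c = fst w * (a * d - b * c)"
         "(fst w * b + snd w * d) * a - (fst w * a + snd w * c) * b = snd w * (a * d - b * c)"
         "(fst w * d - snd w * c) * a + (snd w * a - fst w * b) * c = fst w * (a * d - b * c)"
         "(fst w * d - snd w * c) * b + (snd w * a - fst w * b) * d = snd w * (a * d - b * c)"
      for w :: "int \<times> int" by (simp_all add: algebra_simps)
    thus "(fst (h w) * d - snd (h w) * c, snd (h w) * a - fst (h w) * b) = w"
         "h (fst w * d - snd w * c, snd w * a - fst w * b) = w" for w :: "int \<times> int"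
      by (simp_all add: h_def det)
  qed auto
  have wt: "wt (h w) = wt w" for w
  proof -
    have "f (fst w + (fst w * (a - 1) + snd w * c)) = f (fst w)"
      by (rule periodic_dvd[of f p, OF f_periodic]) (use cong in auto)
    moreover have "G (snd w + (fst w * b + snd w * (d - 1))) = G (snd w)"
      by (rule periodic_dvd[of G q, OF G_periodic]) (use cong in auto)
    ultimately show ?thesis by (simp add: wt_def h_def algebra_simps)
  qed
  have lin: "of_int A * ?\<tau>' + of_int D = (of_int (A * a + D * c) * \<tau> + of_int (A * b + D * d)) / j" for A D
    using nz by (simp add: j_def field_simps)
  have diff: "lattice_diff k ?\<tau>' (0, 0) (0, 1) w = j ^ k * lattice_diff k \<tau> (0, 0) (c, d) (h w)" for w
    unfolding lattice_diff_def lin by (simp add: h_def power_divide ring_distribs add_ac)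
  from has_sum_reindex_bij_betw[OF bij, of "\<lambda>w. wt w * lattice_diff k \<tau> (0, 0) (c, d) w"] 1
  have "((\<lambda>w. wt w * lattice_diff k \<tau> (0, 0) (c, d) (h w)) has_sum lattice_sum \<tau>) UNIV"
    by (simp add: wt)
  hence "((\<lambda>w. j ^ k * (wt w * lattice_diff k \<tau> (0, 0) (c, d) (h w))) has_sum j ^ k * lattice_sum \<tau>) UNIV"
    by (rule has_sum_cmult_right)
  hence "((\<lambda>w. wt w * lattice_diff k ?\<tau>' (0, 0) (0, 1) w) has_sum j ^ k * lattice_sum \<tau>) UNIV"
    unfolding diff by (simp add: mult_ac)
  from has_sum_unique[OF has_sum_lattice_sum[OF \<tau>'] this] show ?thesis by (simp add: j_def)
qed

end

subsection \<open>Finite Fourier transform\<close>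

lemma ee_add_of_int: "ee (z + of_int n) = ee z"
  by (simp add: ee_add ee_of_int)

lemma sum_ee_multiples:
  assumes q: "q > 0"
  shows "(\<Sum>u\<in>{0..<int q}. ee (of_int u * of_int m / of_nat q)) = (if int q dvd m then of_nat q else 0)"
proof -
  define x where "x = ee (of_int m / of_nat q)"
  have "(\<Sum>u\<in>{0..<int q}. ee (of_int u * of_int m / of_nat q)) = (\<Sum>u<q. ee (of_nat u * (of_int m / of_nat q)))"
    by (rule sum.reindex_bij_witness[of _ int nat]) auto
  also have "\<dots> = (\<Sum>u<q. x ^ u)" by (simp add: ee_of_nat_mult[symmetric] x_def)
  also have "\<dots> = (if int q dvd m then of_nat q else 0)"
  proof (cases "int q dvd m")
    case True
    then obtain t where "m = int q * t" by blast
    hence "x = 1" using q ee_of_int[of t] by (simp add: x_def)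
    thus ?thesis using True by simp
  next
    case False
    have "x \<noteq> 1"
    proof
      assume "x = 1"
      then obtain n :: int where "2 * of_real pi * \<i> * (of_int m / of_nat q) = complex_of_real (of_int (2 * n) * pi) * \<i>"
        unfolding x_def ee_def exp_eq_1 by (auto simp: complex_eq_iff)
      hence "complex_of_int m = of_int (int q * n)" using q by (simp add: field_simps)
      hence "m = int q * n" by (simp only: of_int_eq_iff)
      thus False using False by simp
    qed
    moreover have "x ^ q = 1"
      unfolding x_def using q ee_of_int[of m] by (simp add: ee_of_nat_mult[symmetric])
    ultimately show ?thesis using False by (simp add: geometric_sum)
  qed
  finally show ?thesis .
qed

lemma sum_periodic_uminus:
  fixes h :: "int \<Rightarrow> complex"
  assumes per: "\<And>n. h (n + int q) = h n" and q: "q > 0"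
  shows "(\<Sum>v\<in>{0..<int q}. h (- v)) = (\<Sum>v\<in>{0..<int q}. h v)"
proof -
  have "(\<Sum>v\<in>{0..<int q}. h (- v)) = (\<Sum>v\<in>{0..<int q}. h ((- v) mod int q))"
    by (simp only: periodic_mod[of h q, OF per])
  also have "\<dots> = (\<Sum>v\<in>{0..<int q}. h v)"
    by (rule sum.reindex_bij_witness[of _ "\<lambda>v. (- v) mod int q" "\<lambda>v. (- v) mod int q"])
       (use q in \<open>auto simp: mod_minus_eq\<close>)
  finally show ?thesis .
qed

definition dft :: "nat \<Rightarrow> (int \<Rightarrow> complex) \<Rightarrow> int \<Rightarrow> complex" where
  "dft q h u = (\<Sum>v\<in>{0..<int q}. h v * ee (- (of_int u * of_int v / of_nat q))) / of_nat q"

lemma dft_periodic: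
  assumes "q > 0"
  shows "dft q h (u + int q) = dft q h u"
proof -
  have "ee (- (of_int (u + int q) * of_int v / of_nat q)) = ee (- (of_int u * of_int v / of_nat q))" for v
  proof -
    have "- (of_int (u + int q) * of_int v / complex_of_nat q) = - (of_int u * of_int v / of_nat q) + of_int (- v)"
      using assms by (simp add: field_simps)
    thus ?thesis by (simp only: ee_add_of_int)
  qed
  thus ?thesis by (simp add: dft_def)
qed

lemma dft_uminus:
  assumes q: "q > 0" and per: "\<And>n. h (n + int q) = h n" and sym: "\<And>n. h (- n) = s * h n"
  shows "dft q h (- u) = s * dft q h u"
proof -
  let ?k = "\<lambda>v. h v * ee (- (of_int (- u) * of_int v / of_nat q))"
  have "?k (n + int q) = ?k n" for n
  proof -
    have "- (of_int (- u) * of_int (n + int q) / complex_of_nat q) = - (of_int (- u) * of_int n / of_nat q) + of_int u"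
      using q by (simp add: field_simps)
    thus ?thesis by (simp only: ee_add_of_int per)
  qed
  from sum_periodic_uminus[of ?k, OF this q]
  have "(\<Sum>v\<in>{0..<int q}. ?k v) = (\<Sum>v\<in>{0..<int q}. ?k (- v))" ..
  also have "\<dots> = s * (\<Sum>v\<in>{0..<int q}. h v * ee (- (of_int u * of_int v / of_nat q)))"
    by (simp add: sym sum_distrib_left mult_ac)
  finally show ?thesis by (simp add: dft_def)
qed

lemma dft_inversion:
  assumes q: "q > 0" and per: "\<And>n. h (n + int q) = h n"
  shows "(\<Sum>u\<in>{0..<int q}. dft q h u * ee (of_int u * of_int B / of_nat q)) = h B"
proof -
  have "(\<Sum>u\<in>{0..<int q}. dft q h u * ee (of_int u * of_int B / of_nat q)) =
      (\<Sum>u\<in>{0..<int q}. \<Sum>v\<in>{0..<int q}. h v * ee (of_int u * of_int (B - v) / of_nat q) / of_nat q)"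
    unfolding dft_def sum_divide_distrib sum_distrib_right
    by (intro sum.cong refl) (simp add: ee_add[symmetric] diff_divide_distrib ring_distribs mult_ac)
  also have "\<dots> = (\<Sum>v\<in>{0..<int q}. \<Sum>u\<in>{0..<int q}. h v * ee (of_int u * of_int (B - v) / of_nat q) / of_nat q)"
    by (rule sum.swap)
  also have "\<dots> = (\<Sum>v\<in>{0..<int q}. h v * (\<Sum>u\<in>{0..<int q}. ee (of_int u * of_int (B - v) / of_nat q)) / of_nat q)"
    by (simp add: sum_distrib_left sum_divide_distrib)
  also have "\<dots> = (\<Sum>v\<in>{0..<int q}. if v = B mod int q then h v else 0)"
  proof (intro sum.cong refl)
    fix v assume v: "v \<in> {0..<int q}"
    have "int q dvd B - v \<longleftrightarrow> v = B mod int q"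
      using v by (auto simp: mod_eq_dvd_iff[symmetric])
    thus "h v * (\<Sum>u\<in>{0..<int q}. ee (of_int u * of_int (B - v) / of_nat q)) / of_nat q
        = (if v = B mod int q then h v else 0)"
      unfolding sum_ee_multiples[OF q] using q by simp
  qed
  also have "\<dots> = h (B mod int q)" using q by simp
  also have "\<dots> = h B" by (rule periodic_mod[of h q, OF per])
  finally show ?thesis .
qed

text \<open>Reducing \<open>d\<close> modulo \<open>q\<close> makes periodicity automatic; the
  vanishing sum over a period is then needed only for the difference relation.\<close>

definition periodic_antidiff :: "nat \<Rightarrow> (int \<Rightarrow> complex) \<Rightarrow> int \<Rightarrow> complex" where
  "periodic_antidiff q g d = (\<Sum>u\<in>{0..d mod int q}. g u)"

lemma periodic_antidiff_periodic: "periodic_antidiff q g (d + int q) = periodic_antidiff q g d"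
  by (simp add: periodic_antidiff_def)

lemma periodic_antidiff_diff:
  assumes q: "q > 0" and per: "\<And>n. g (n + int q) = g n" and sum0: "(\<Sum>u\<in>{0..<int q}. g u) = 0"
  shows "periodic_antidiff q g d - periodic_antidiff q g (d - 1) = g d"
proof -
  define r where "r = d mod int q"
  have r: "0 \<le> r" "r < int q" using q by (auto simp: r_def)
  have g: "g d = g r" using periodic_mod[of g q d, OF per] by (simp add: r_def)
  have r1: "(d - 1) mod int q = (r - 1) mod int q" by (simp add: r_def mod_simps)
  show ?thesis
  proof (cases "r = 0")
    case True
    \<comment> \<open>When \<open>q\<close> divides \<open>d\<close>, the preceding partial sum runs
      over a full period and vanishes.\<close>
    have "(- 1) mod int q = int q - 1" using q by (simp add: zmod_minus1)
    moreover have "{0..int q - 1} = {0..<int q}" by auto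
    ultimately show ?thesis
      using True sum0 by (simp add: periodic_antidiff_def r1 g r_def[symmetric])
  next
    case False
    hence "(r - 1) mod int q = r - 1" using r by simp
    moreover have "{0..r} = insert r {0..r - 1}" using r by auto
    ultimately show ?thesis
      by (simp add: periodic_antidiff_def r1 g r_def[symmetric])
  qed
qed

text \<open>On the residue class of \<open>u\<close> the weight is constant and
  \<open>w + u + q n = q * ((w + u) / q + n)\<close>, so the Lipschitz formula applies. Summing over
  \<open>u\<close>, Fourier inversion recombines the factors \<open>ee (u * Suc m / q)\<close> into
  \<open>h (Suc m)\<close>.\<close>

lemma has_sum_twisted_Lipschitz:
  fixes h :: "int \<Rightarrow> complex"
  assumes q: "q > 0" and per: "\<And>n. h (n + int q) = h n" and k: "k \<ge> 2" and w: "w \<in> uhp"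
  shows "((\<lambda>d. dft q h d * (1 / (w + of_int d) ^ k)) has_sum
           lipschitz_const k / of_nat q ^ k *
             qseries (\<lambda>m. h (int (Suc m)) * of_nat (Suc m) ^ (k - 1)) (w / of_nat q)) UNIV"
proof -
  define g where "g = dft q h"
  define L where "L = lipschitz_const k / of_nat q ^ k"
  have g_per: "g (n + int q) = g n" for n unfolding g_def by (rule dft_periodic[OF q])
  have uhp: "(w + of_int u) / of_nat q \<in> uhp" for u :: int
    using w q by (simp add: uhp_def)
  have residue: "((\<lambda>d. g d * (1 / (w + of_int d) ^ k)) has_sum
      g u * L * qseries (\<lambda>m. of_nat (Suc m) ^ (k - 1)) ((w + of_int u) / of_nat q)) {d. d mod int q = u}"
    if u: "u \<in> {0..<int q}" for u
  proof -
    have "((\<lambda>n. g u / of_nat q ^ k * (1 / ((w + of_int u) / of_nat q + of_int n) ^ k)) has_sum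
        g u / of_nat q ^ k * (lipschitz_const k * qseries (\<lambda>m. of_nat (Suc m) ^ (k - 1)) ((w + of_int u) / of_nat q))) UNIV"
      by (intro has_sum_cmult_right Lipschitz_formula uhp k)
    moreover have "g u / of_nat q ^ k * (1 / ((w + of_int u) / of_nat q + of_int n) ^ k)
        = g (u + int q * n) * (1 / (w + of_int (u + int q * n)) ^ k)" for n
    proof -
      have "w + of_int (u + int q * n) = of_nat q * ((w + of_int u) / of_nat q + of_int n)"
        using q by (simp add: field_simps)
      thus ?thesis using periodic_dvd[of g q "int q * n" u, OF g_per] by (simp add: power_mult_distrib)
    qed
    ultimately have *: "((\<lambda>n. g (u + int q * n) * (1 / (w + of_int (u + int q * n)) ^ k)) has_sum
        g u * L * qseries (\<lambda>m. of_nat (Suc m) ^ (k - 1)) ((w + of_int u) / of_nat q)) UNIV"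
      by (simp add: L_def mult_ac)
    have "bij_betw (\<lambda>n. u + int q * n) UNIV {d. d mod int q = u}"
      by (rule bij_betwI[of _ _ _ "\<lambda>d. d div int q"]) (use u q in auto)
    from has_sum_reindex_bij_betw[OF this, of "\<lambda>d. g d * (1 / (w + of_int d) ^ k)"] *
    show ?thesis by simp
  qed
  have "((\<lambda>d. g d * (1 / (w + of_int d) ^ k)) has_sum
      (\<Sum>u\<in>{0..<int q}. g u * L * qseries (\<lambda>m. of_nat (Suc m) ^ (k - 1)) ((w + of_int u) / of_nat q)))
      (\<Union>u\<in>{0..<int q}. {d. d mod int q = u})"
    by (rule sum_has_sum) (use residue in auto)
  also have "(\<Union>u\<in>{0..<int q}. {d. d mod int q = u}) = UNIV" using q by auto
  also have "(\<Sum>u\<in>{0..<int q}. g u * L * qseries (\<lambda>m. of_nat (Suc m) ^ (k - 1)) ((w + of_int u) / of_nat q))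
      = L * qseries (\<lambda>m. h (int (Suc m)) * of_nat (Suc m) ^ (k - 1)) (w / of_nat q)"
  proof -
    have "(\<lambda>m. of_nat (Suc m) ^ (k - 1) * ee (of_nat (Suc m) * ((w + of_int u) / of_nat q))) sums
        qseries (\<lambda>m. of_nat (Suc m) ^ (k - 1)) ((w + of_int u) / of_nat q)" for u :: int
      unfolding qseries_def
      by (intro summable_sums summable_norm_cancel[OF summable_norm_qseries[OF disc_summable_Suc_power uhp]])
    hence "(\<lambda>m. \<Sum>u\<in>{0..<int q}. g u * (of_nat (Suc m) ^ (k - 1) * ee (of_nat (Suc m) * ((w + of_int u) / of_nat q)))) sums
        (\<Sum>u\<in>{0..<int q}. g u * qseries (\<lambda>m. of_nat (Suc m) ^ (k - 1)) ((w + of_int u) / of_nat q))"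
      by (intro sums_sum sums_mult)
    also have "(\<lambda>m. \<Sum>u\<in>{0..<int q}. g u * (of_nat (Suc m) ^ (k - 1) * ee (of_nat (Suc m) * ((w + of_int u) / of_nat q))))
      = (\<lambda>m. h (int (Suc m)) * of_nat (Suc m) ^ (k - 1) * ee (of_nat (Suc m) * (w / of_nat q)))"
    proof
      fix m
      have "ee (of_nat (Suc m) * ((w + of_int u) / of_nat q)) =
          ee (of_int u * of_int (int (Suc m)) / of_nat q) * ee (of_nat (Suc m) * (w / of_nat q))" for u :: int
        unfolding ee_add[symmetric] by (rule arg_cong[of _ _ ee]) (use q in \<open>simp add: field_simps\<close>)
      hence "(\<Sum>u\<in>{0..<int q}. g u * (of_nat (Suc m) ^ (k - 1) * ee (of_nat (Suc m) * ((w + of_int u) / of_nat q))))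
        = (\<Sum>u\<in>{0..<int q}. g u * ee (of_int u * of_int (int (Suc m)) / of_nat q)) *
            (of_nat (Suc m) ^ (k - 1) * ee (of_nat (Suc m) * (w / of_nat q)))"
        unfolding sum_distrib_right by (intro sum.cong refl) (simp only: mult_ac)
      thus "(\<Sum>u\<in>{0..<int q}. g u * (of_nat (Suc m) ^ (k - 1) * ee (of_nat (Suc m) * ((w + of_int u) / of_nat q))))
        = h (int (Suc m)) * of_nat (Suc m) ^ (k - 1) * ee (of_nat (Suc m) * (w / of_nat q))"
        unfolding g_def dft_inversion[of q h, OF q per] by (simp add: mult_ac)
    qed
    finally show ?thesis
      by (simp add: sums_iff qseries_def sum_distrib_left mult_ac del: of_nat_Suc)
  qed
  finally show ?thesis by (simp add: g_def L_def)
qed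

lemma has_sum_positive_nat_iff:
  fixes a :: "nat \<Rightarrow> complex"
  shows "(a has_sum s) {0<..} \<longleftrightarrow> ((\<lambda>n. a (Suc n)) has_sum s) UNIV"
proof -
  have "bij_betw Suc UNIV {0<..}"
    by (rule bij_betwI[of _ _ _ "\<lambda>n. n - 1"]) auto
  from has_sum_reindex_bij_betw[OF this, of a] show ?thesis by simp
qed

lemma has_sum_qseries:
  assumes "disc_summable c" "z \<in> uhp"
  shows "((\<lambda>n. c n * ee (of_nat (Suc n) * z)) has_sum qseries c z) UNIV"
proof (rule norm_summable_imp_has_sum[OF summable_norm_qseries[OF assms]])
  show "(\<lambda>n. c n * ee (of_nat (Suc n) * z)) sums qseries c z"
    unfolding qseries_def
    by (intro summable_sums summable_norm_cancel[OF summable_norm_qseries[OF assms]])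
qed

lemma has_sum_even_int:
  fixes H :: "int \<Rightarrow> complex"
  assumes S: "(H has_sum S) UNIV" and even: "\<And>A. H (- A) = H A" and "H 0 = 0"
    and b: "((\<lambda>n. H (int (Suc n))) has_sum b) UNIV"
  shows "S = 2 * b"
proof -
  have "((\<lambda>n. H (int n)) has_sum b) {0<..}" using b by (simp only: has_sum_positive_nat_iff)
  hence "((\<lambda>n. H (int n)) has_sum (H (int 0) + b)) (insert 0 {0<..})"
    by (intro has_sum_insert) auto
  also have "insert 0 {0<..} = (UNIV :: nat set)" by auto
  finally have "((\<lambda>n. H (int n)) has_sum b) UNIV" using assms(3) by simp
  moreover have "H (- 1 - int n) = H (int (Suc n))" for n
    using even[of "int (Suc n)"] by (simp add: algebra_simps)
  ultimately have "(H has_sum b + b) UNIV"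
    using b by (intro has_sum_int_halves) auto
  thus ?thesis using S has_sum_unique by fastforce
qed

subsection \<open>The Fourier expansion of the lattice sum\<close>

lemma sum_divisors_power_le:
  assumes N: "N > 0"
  shows "(\<Sum>A\<in>{A. A dvd N}. real (N div A) ^ j) \<le> real N ^ Suc j"
proof -
  have "(\<Sum>A\<in>{A. A dvd N}. real (N div A) ^ j) \<le> (\<Sum>A\<in>{A. A dvd N}. real N ^ j)"
    by (intro sum_mono power_mono) auto
  also have "\<dots> = real (card {A. A dvd N}) * real N ^ j" by simp
  also have "card {A. A dvd N} \<le> card {1..N}"
    using N by (intro card_mono) (auto dest: dvd_imp_le intro: Nat.gr0I)
  hence "real (card {A. A dvd N}) * real N ^ j \<le> real N * real N ^ j"
    by (intro mult_right_mono) auto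
  finally show ?thesis by simp
qed

lemma uhp_of_nat_mult: "z \<in> uhp \<Longrightarrow> n > 0 \<Longrightarrow> of_nat n * z \<in> uhp"
  by (simp add: uhp_def)

text \<open>\<open>f\<close> and \<open>h\<close> stand for \<open>chi1\<close> and the conjugate of
  \<open>chi2\<close>, \<open>s\<close> and \<open>t\<close> for their values at \<open>- 1\<close>.
  The condition on \<open>s * t\<close> makes the lattice rows \<open>A\<close> and
  \<open>- A\<close> equal rather than opposite.\<close>

locale eisenstein_pair =
  fixes f h :: "int \<Rightarrow> complex" and p q k :: nat and s t :: complex
  assumes p: "p > 0" and q: "q > 0" and k: "k \<ge> 2"
    and f_periodic: "\<And>n. f (n + int p) = f n"
    and h_periodic: "\<And>n. h (n + int q) = h n"
    and f_0: "f 0 = 0" and h_0: "h 0 = 0"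
    and f_uminus: "\<And>n. f (- n) = s * f n" and h_uminus: "\<And>n. h (- n) = t * h n"
    and parity: "s * t = (- 1) ^ k"
begin

sublocale periodic_pair f "periodic_antidiff q (dft q h)" p q k
  by unfold_locales (use p q k f_periodic f_0 periodic_antidiff_periodic in auto)

definition row_coeff :: "nat \<Rightarrow> complex" where
  "row_coeff m = h (int (Suc m)) * of_nat (Suc m) ^ (k - 1)"

definition coeff :: "nat \<Rightarrow> complex" where
  "coeff n = (\<Sum>A\<in>{A. A dvd Suc n}. f (int A) * h (int (Suc n div A)) * of_nat (Suc n div A) ^ (k - 1))"

lemma bounded_pair:
  obtains M where "M \<ge> 0" "\<And>n. norm (f n) \<le> M" "\<And>n. norm (h n) \<le> M"
proof -
  obtain M1 where M1: "M1 \<ge> 0" "\<And>n. norm (f n) \<le> M1"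
    using periodic_bounded[of f p, OF f_periodic p] by blast
  obtain M2 where M2: "M2 \<ge> 0" "\<And>n. norm (h n) \<le> M2"
    using periodic_bounded[of h q, OF h_periodic q] by blast
  show ?thesis
    using that[of "max M1 M2"] M1 M2 by (meson max.cobounded1 max.cobounded2 order.trans)
qed

lemma norm_coeff_le:
  obtains M where "M \<ge> 0" "\<And>N. N > 0 \<Longrightarrow>
    (\<Sum>A\<in>{A. A dvd N}. norm (f (int A) * h (int (N div A)) * of_nat (N div A) ^ (k - 1))) \<le> M * real N ^ k"
proof -
  obtain M where M: "M \<ge> 0" "\<And>n. norm (f n) \<le> M" "\<And>n. norm (h n) \<le> M"
    using bounded_pair by blast
  show ?thesis
  proof (rule that[of "M * M"])
    fix N :: nat assume N: "N > 0"
    have "(\<Sum>A\<in>{A. A dvd N}. norm (f (int A) * h (int (N div A)) * of_nat (N div A) ^ (k - 1)))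
        \<le> (\<Sum>A\<in>{A. A dvd N}. M * M * real (N div A) ^ (k - 1))"
      unfolding norm_mult norm_power norm_of_nat using M by (intro sum_mono mult_mono) auto
    also have "\<dots> \<le> M * M * real N ^ Suc (k - 1)"
      unfolding sum_distrib_left[symmetric] using M N
      by (intro mult_left_mono sum_divisors_power_le) auto
    finally show "(\<Sum>A\<in>{A. A dvd N}. norm (f (int A) * h (int (N div A)) * of_nat (N div A) ^ (k - 1)))
        \<le> M * M * real N ^ k" using k by simp
  qed (use M in auto)
qed

lemma disc_summable_coeff: "disc_summable coeff"
proof -
  obtain M where "M \<ge> 0" and M: "\<And>N. N > 0 \<Longrightarrow>
    (\<Sum>A\<in>{A. A dvd N}. norm (f (int A) * h (int (N div A)) * of_nat (N div A) ^ (k - 1))) \<le> M * real N ^ k"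
    using norm_coeff_le by blast
  show ?thesis
  proof (rule disc_summable_poly_bound)
    show "norm (coeff n) \<le> M * real (Suc n) ^ k" for n
      unfolding coeff_def by (rule order.trans[OF norm_sum M]) auto
  qed
qed

lemma disc_summable_row_coeff: "disc_summable row_coeff"
proof -
  obtain M where M: "M \<ge> 0" "\<And>n. norm (f n) \<le> M" "\<And>n. norm (h n) \<le> M"
    using bounded_pair by blast
  show ?thesis
    by (rule disc_summable_poly_bound[of _ M "k - 1"])
       (use M in \<open>auto simp: row_coeff_def norm_mult norm_power simp del: of_nat_Suc intro!: mult_right_mono\<close>)
qed

text \<open>A divisor sum is a double series over \<open>N = A * B\<close>: grouped by
  \<open>N\<close> it yields \<open>coeff\<close>, grouped by \<open>A\<close> the rows. Polynomial
  growth of the divisor sums against the exponential decay of \<open>ee\<close> gives the absolute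
  convergence that permits both groupings.\<close>

lemma has_sum_rows:
  assumes z: "z \<in> uhp"
  shows "((\<lambda>A. f (int (Suc A)) * qseries row_coeff (of_nat (Suc A) * z)) has_sum qseries coeff z) UNIV"
proof -
  define F where "F = (\<lambda>(A, B). f (int A) * h (int B) * of_nat B ^ (k - 1) * ee (of_nat (A * B) * z))"
  define D where "D N = {A. A dvd N}" for N :: nat
  define e where "e N = F \<circ> (\<lambda>A. (A, N div A))" for N
  have fin: "finite (D N)" if "N \<in> {0<..}" for N using that by (auto simp: D_def)
  have e: "e N A = f (int A) * h (int (N div A)) * of_nat (N div A) ^ (k - 1) * ee (of_nat N * z)"
    if "A \<in> D N" for N A using that by (simp add: e_def F_def D_def del: of_nat_mult)
  obtain M where M0: "M \<ge> 0" and M: "\<And>N. N > 0 \<Longrightarrow>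
    (\<Sum>A\<in>{A. A dvd N}. norm (f (int A) * h (int (N div A)) * of_nat (N div A) ^ (k - 1))) \<le> M * real N ^ k"
    using norm_coeff_le by blast
  have "(\<lambda>(N, A). norm (e N A)) summable_on Sigma {0<..} D"
  proof (rule summable_on_SigmaI[where g = "\<lambda>N. \<Sum>A\<in>D N. norm (e N A)"])
    show "((\<lambda>A. case (N, A) of (N, A) \<Rightarrow> norm (e N A)) has_sum (\<Sum>A\<in>D N. norm (e N A))) (D N)"
      if "N \<in> {0<..}" for N using has_sum_finite[OF fin[OF that]] by simp
    have "summable (\<lambda>n. norm (of_nat (Suc n) ^ k * ee (of_nat (Suc n) * z)))"
      by (rule summable_norm_qseries[OF disc_summable_Suc_power z])
    hence "(\<lambda>n. M * norm (of_nat (Suc n) ^ k * ee (of_nat (Suc n) * z))) summable_on UNIV"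
      by (intro summable_on_cmult_right summable_nonneg_imp_summable_on) auto
    moreover have "bij_betw Suc UNIV {0<..}"
      by (rule bij_betwI[of _ _ _ "\<lambda>n. n - 1"]) auto
    ultimately have "(\<lambda>N. M * norm (of_nat N ^ k * ee (of_nat N * z))) summable_on {0<..}"
      using summable_on_reindex_bij_betw[of Suc UNIV "{0<..}" "\<lambda>N. M * norm (of_nat N ^ k * ee (of_nat N * z))"]
      by simp
    thus "(\<lambda>N. \<Sum>A\<in>D N. norm (e N A)) summable_on {0<..}"
    proof (rule summable_on_comparison_test)
      fix N :: nat assume N: "N \<in> {0<..}"
      have "(\<Sum>A\<in>D N. norm (e N A)) =
        (\<Sum>A\<in>D N. norm (f (int A) * h (int (N div A)) * of_nat (N div A) ^ (k - 1))) * norm (ee (of_nat N * z))"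
        unfolding sum_distrib_right by (intro sum.cong refl) (simp add: e norm_mult)
      also have "\<dots> \<le> (M * real N ^ k) * norm (ee (of_nat N * z))"
        using M[of N] N by (intro mult_right_mono) (auto simp: D_def)
      finally show "(\<Sum>A\<in>D N. norm (e N A)) \<le> M * norm (of_nat N ^ k * ee (of_nat N * z))"
        by (simp add: norm_mult norm_power mult.assoc)
    qed (auto intro: sum_nonneg)
  qed auto
  hence "(\<lambda>x. norm (case x of (N, A) \<Rightarrow> e N A)) summable_on Sigma {0<..} D"
    by (simp add: case_prod_unfold)
  hence "(\<lambda>(N, A). e N A) summable_on Sigma {0<..} D"
    by (rule abs_summable_summable)
  then obtain T where T: "((\<lambda>(N, A). e N A) has_sum T) (Sigma {0<..} D)"
    by (auto simp: summable_on_def)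
  have "((\<lambda>N. \<Sum>A\<in>D N. e N A) has_sum T) {0<..}"
    by (rule has_sum_Sigma'[OF T]) (use has_sum_finite[OF fin] in auto)
  hence "((\<lambda>n. \<Sum>A\<in>D (Suc n). e (Suc n) A) has_sum T) UNIV"
    by (simp only: has_sum_positive_nat_iff)
  also have "(\<lambda>n. \<Sum>A\<in>D (Suc n). e (Suc n) A) = (\<lambda>n. coeff n * ee (of_nat (Suc n) * z))"
    unfolding coeff_def sum_distrib_right by (auto simp: D_def e intro!: sum.cong)
  finally have T_eq: "T = qseries coeff z"
    using has_sum_unique has_sum_qseries[OF disc_summable_coeff z] by blast
  have "bij_betw (\<lambda>(N, A). (A, N div A)) (Sigma {0<..} D) ({0<..} \<times> {0<..})"
    by (rule bij_betwI[of _ _ _ "\<lambda>(A, B). (A * B, A)"])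
       (auto simp: D_def elim!: dvdE)
  from has_sum_reindex_bij_betw[OF this, of F T] T
  have "(F has_sum T) ({0<..} \<times> {0<..})" by (simp add: e_def case_prod_unfold o_def)
  hence "((\<lambda>A. f (int A) * qseries row_coeff (of_nat A * z)) has_sum T) {0<..}"
  proof (rule has_sum_Sigma')
    fix A :: nat assume A: "A \<in> {0<..}"
    have "of_nat A * z \<in> uhp" using A z by (simp add: uhp_def)
    from has_sum_cmult_right[OF has_sum_qseries[OF disc_summable_row_coeff this], of "f (int A)"]
    have "((\<lambda>m. F (A, Suc m)) has_sum f (int A) * qseries row_coeff (of_nat A * z)) UNIV"
      by (simp add: F_def row_coeff_def mult_ac del: of_nat_Suc)
    thus "((\<lambda>B. F (A, B)) has_sum f (int A) * qseries row_coeff (of_nat A * z)) {0<..}"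
      by (simp only: has_sum_positive_nat_iff)
  qed
  thus ?thesis by (simp only: has_sum_positive_nat_iff T_eq)
qed

text \<open>Summation by parts: \<open>dft q h\<close> has mean value \<open>h 0 = 0\<close>, so it is the difference of a periodic
  sequence, which is the weight used in the lattice sum.\<close>
definition lattice_row :: "complex \<Rightarrow> int \<Rightarrow> complex" where
  "lattice_row \<tau> A = (\<Sum>\<^sub>\<infinity>d. f A * dft q h d * (1 / (of_int A * \<tau> + of_int d) ^ k))"

lemma dft_sum_0: "(\<Sum>u\<in>{0..<int q}. dft q h u) = 0"
  using dft_inversion[of q h 0, OF q h_periodic] by (simp add: h_0 ee_def)

lemma has_sum_lattice_row:
  assumes \<tau>: "\<tau> \<in> uhp"
  shows "((\<lambda>d. wt (A, d) * lattice_diff k \<tau> (0, 0) (0, 1) (A, d)) has_sum lattice_row \<tau> A) UNIV"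
proof -
  let ?G = "periodic_antidiff q (dft q h)"
  let ?\<phi> = "\<lambda>d. 1 / (of_int A * \<tau> + of_int d) ^ k"
  obtain a where a: "((\<lambda>d. f A * ?G d * ?\<phi> d) has_sum a) UNIV"
    using abs_summable_summable[OF summable_row[OF \<tau>, of 0 A 0]] by (auto simp: summable_on_def)
  obtain b where b: "((\<lambda>d. f A * ?G d * ?\<phi> (d + 1)) has_sum b) UNIV"
    using abs_summable_summable[OF summable_row[OF \<tau>, of 0 A 1]] by (auto simp: summable_on_def)
  \<comment> \<open>The translation moves the shift from the denominator to the antidifference, so
    both forms of the row have the sum \<open>a - b\<close>.\<close>
  have "((\<lambda>d. f A * ?G (d - 1) * ?\<phi> d) has_sum b) UNIV"
    using has_sum_int_translate[OF b, of "- 1"] by simp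
  from has_sum_add[OF a has_sum_uminusI[OF this]]
  have "((\<lambda>d. f A * (?G d - ?G (d - 1)) * ?\<phi> d) has_sum (a - b)) UNIV"
    by (simp add: algebra_simps diff_divide_distrib)
  hence "((\<lambda>d. f A * dft q h d * ?\<phi> d) has_sum (a - b)) UNIV"
    by (subst (asm) periodic_antidiff_diff[OF q dft_periodic[OF q] dft_sum_0])
  hence row: "lattice_row \<tau> A = a - b" unfolding lattice_row_def by (rule infsumI)
  have "((\<lambda>d. f A * ?G d * ?\<phi> d + - (f A * ?G d * ?\<phi> (d + 1))) has_sum (a - b)) UNIV"
    using has_sum_add[OF a has_sum_uminusI[OF b]] by simp
  thus ?thesis
    unfolding row by (simp add: wt_def lattice_diff_def algebra_simps)
qed

lemma has_sum_lattice_rows: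
  assumes \<tau>: "\<tau> \<in> uhp"
  shows "(lattice_row \<tau> has_sum lattice_sum \<tau>) UNIV"
  by (rule has_sum_Sigma'[where B = "\<lambda>_. UNIV"])
     (use has_sum_lattice_sum[OF \<tau>] has_sum_lattice_row[OF \<tau>] in auto)

lemma lattice_row_uminus: "lattice_row \<tau> (- A) = lattice_row \<tau> A"
proof -
  have "lattice_row \<tau> (- A) = (\<Sum>\<^sub>\<infinity>d. f (- A) * dft q h (- d) * (1 / (of_int (- A) * \<tau> + of_int (- d)) ^ k))"
    unfolding lattice_row_def
    by (rule infsum_reindex_bij_witness[of _ uminus uminus]) auto
  also have "\<dots> = lattice_row \<tau> A"
    unfolding lattice_row_def
  proof (rule infsum_cong)
    fix d :: int
    have "of_int (- A) * \<tau> + of_int (- d) = - (of_int A * \<tau> + of_int d)" by simp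
    hence "f (- A) * dft q h (- d) * (1 / (of_int (- A) * \<tau> + of_int (- d)) ^ k) =
      (s * t * (- 1) ^ k) * (f A * dft q h d * (1 / (of_int A * \<tau> + of_int d) ^ k))"
      by (simp only: f_uminus dft_uminus[of q h t, OF q h_periodic h_uminus] power_minus[of "of_int A * \<tau> + of_int d"])
         (cases "even k"; simp)
    thus "f (- A) * dft q h (- d) * (1 / (of_int (- A) * \<tau> + of_int (- d)) ^ k) =
        f A * dft q h d * (1 / (of_int A * \<tau> + of_int d) ^ k)"
      by (simp add: parity power_mult_distrib[symmetric])
  qed
  finally show ?thesis .
qed

text \<open>Row \<open>A\<close> at \<open>q * z\<close> has the Lipschitz argument
  \<open>A * q * z\<close>, and the twisted formula divides it by \<open>q\<close>, leaving the
  \<open>A * z\<close> of the divisor sum.\<close>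

lemma lattice_row_Suc:
  assumes z: "z \<in> uhp"
  shows "lattice_row (of_nat q * z) (int (Suc n)) =
    lipschitz_const k / of_nat q ^ k * (f (int (Suc n)) * qseries row_coeff (of_nat (Suc n) * z))"
proof -
  define w where "w = of_int (int (Suc n)) * (of_nat q * z)"
  have w: "w \<in> uhp" using z q by (simp add: w_def uhp_def)
  have wq: "w / of_nat q = of_nat (Suc n) * z" using q by (simp add: w_def)
  have "((\<lambda>d. dft q h d * (1 / (w + of_int d) ^ k)) has_sum
           lipschitz_const k / of_nat q ^ k * qseries row_coeff (w / of_nat q)) UNIV"
    using has_sum_twisted_Lipschitz[of q h k w, OF q h_periodic k w]
    unfolding row_coeff_def[abs_def] .
  from has_sum_cmult_right[OF this, of "f (int (Suc n))"]
  have "((\<lambda>d. f (int (Suc n)) * dft q h d * (1 / (w + of_int d) ^ k)) has_sum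
           lipschitz_const k / of_nat q ^ k * (f (int (Suc n)) * qseries row_coeff (of_nat (Suc n) * z))) UNIV"
    unfolding wq by (simp add: mult_ac del: of_nat_Suc)
  thus ?thesis unfolding lattice_row_def w_def by (rule infsumI)
qed

text \<open>Row 0 vanishes with \<open>f 0\<close>, and rows \<open>A\<close> and \<open>- A\<close>
  agree; hence the factor 2.\<close>

lemma lattice_sum_eq_qseries:
  assumes z: "z \<in> uhp"
  shows "lattice_sum (of_nat q * z) = 2 * (lipschitz_const k / of_nat q ^ k * qseries coeff z)"
proof (rule has_sum_even_int)
  have \<tau>: "of_nat q * z \<in> uhp" using z q by (simp add: uhp_def)
  show "(lattice_row (of_nat q * z) has_sum lattice_sum (of_nat q * z)) UNIV"
    by (rule has_sum_lattice_rows[OF \<tau>])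
  show "lattice_row (of_nat q * z) 0 = 0" by (simp add: lattice_row_def f_0)
  show "((\<lambda>n. lattice_row (of_nat q * z) (int (Suc n))) has_sum
          lipschitz_const k / of_nat q ^ k * qseries coeff z) UNIV"
    unfolding lattice_row_Suc[OF z] by (intro has_sum_cmult_right has_sum_rows z)
qed (rule lattice_row_uminus)

text \<open>Conjugation by \<open>z \<mapsto> q * z\<close> turns \<open>(a, b, c, d)\<close> into
  \<open>(a, b * q, c / q, d)\<close>, which satisfies the congruences of
  \<open>lattice_sum_modular\<close>. The nonzero constant between lattice sum and q-series
  cancels.\<close>

lemma qseries_coeff_modular:
  fixes a b c d :: int
  assumes z: "z \<in> uhp" and det: "a * d - b * c = 1"
    and cong: "[c = 0] (mod int (p * q))" "[a = 1] (mod int (p * q))" "[d = 1] (mod int (p * q))"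
    and z': "(of_int a * z + of_int b) / (of_int c * z + of_int d) \<in> uhp"
    and nz: "of_int c * z + of_int d \<noteq> 0"
  shows "qseries coeff ((of_int a * z + of_int b) / (of_int c * z + of_int d))
         = (of_int c * z + of_int d) ^ k * qseries coeff z"
proof -
  let ?z' = "(of_int a * z + of_int b) / (of_int c * z + of_int d)"
  from cong(1) obtain m where m: "c = int (p * q) * m" by (auto simp: cong_0_iff)
  define c' where "c' = int p * m"
  have c': "c = int q * c'" by (simp add: m c'_def)
  let ?\<tau> = "of_nat q * z"
  have \<tau>: "?\<tau> \<in> uhp" "of_nat q * ?z' \<in> uhp"
    by (rule uhp_of_nat_mult[OF z q], rule uhp_of_nat_mult[OF z' q])
  have j: "of_int c' * ?\<tau> + of_int d = of_int c * z + of_int d"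
    by (simp add: c')
  have t: "(of_int a * ?\<tau> + of_int (b * int q)) / (of_int c * z + of_int d) = of_nat q * ?z'"
    by (simp add: algebra_simps)
  have dvd: "int (p * q) dvd a - 1" "int (p * q) dvd d - 1"
    using cong by (auto simp: cong_iff_dvd_diff)
  have "lattice_sum ((of_int a * ?\<tau> + of_int (b * int q)) / (of_int c' * ?\<tau> + of_int d))
      = (of_int c' * ?\<tau> + of_int d) ^ k * lattice_sum ?\<tau>"
  proof (rule lattice_sum_modular)
    show "a * d - b * int q * c' = 1" using det by (simp add: c' mult_ac)
    show "int p dvd a - 1" "int q dvd d - 1"
      using dvd by (auto intro: dvd_trans[of _ "int (p * q)"])
    show "int q dvd b * int q" "int p dvd c'" by (auto simp: c'_def)
    show "(of_int a * ?\<tau> + of_int (b * int q)) / (of_int c' * ?\<tau> + of_int d) \<in> uhp"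
      unfolding j t by (rule \<tau>)
    show "of_int c' * ?\<tau> + of_int d \<noteq> 0" unfolding j by (rule nz)
  qed (rule \<tau>)
  thus ?thesis
    unfolding t j lattice_sum_eq_qseries[OF z] lattice_sum_eq_qseries[OF z']
    using lipschitz_const_nonzero[of k] q by simp
qed

end

subsection \<open>Moebius transformations\<close>

fun mobius :: "int \<times> int \<times> int \<times> int \<Rightarrow> complex \<Rightarrow> complex" where
  "mobius (a, b, c, d) z = (of_int a * z + of_int b) / (of_int c * z + of_int d)"

fun SL2_mult :: "int \<times> int \<times> int \<times> int \<Rightarrow> int \<times> int \<times> int \<times> int \<Rightarrow> int \<times> int \<times> int \<times> int" where
  "SL2_mult (a, b, c, d) (a', b', c', d') =
     (a * a' + b * c', a * b' + b * d', c * a' + d * c', c * b' + d * d')"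

lemma denominator_nonzero:
  fixes a b c d :: int
  assumes "z \<in> uhp" "a * d - b * c = 1"
  shows "of_int c * z + of_int d \<noteq> 0"
proof
  assume "of_int c * z + of_int d = 0"
  hence "real_of_int c * Im z = 0" "real_of_int c * Re z + of_int d = 0"
    by (simp_all add: complex_eq_iff)
  hence "c = 0" "d = 0" using assms(1) by (auto simp: uhp_def)
  thus False using assms(2) by simp
qed

lemma Im_mobius:
  assumes "a * d - b * c = 1"
  shows "Im (mobius (a, b, c, d) z) = Im z / (norm (of_int c * z + of_int d))\<^sup>2"
proof -
  have "Im (mobius (a, b, c, d) z) = of_int (a * d - b * c) * Im z / (norm (of_int c * z + of_int d))\<^sup>2"
    unfolding mobius.simps Im_divide cmod_power2 by (simp add: algebra_simps)
  thus ?thesis by (simp add: assms)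
qed

lemma mobius_uhp:
  assumes "z \<in> uhp" "a * d - b * c = 1"
  shows "mobius (a, b, c, d) z \<in> uhp"
  using denominator_nonzero[OF assms] assms(1) by (simp add: uhp_def Im_mobius[OF assms(2)] del: mobius.simps)

lemma mobius_SL2_mult:
  assumes z: "z \<in> uhp" and "a * d - b * c = 1" "a' * d' - b' * c' = 1"
  shows "mobius (SL2_mult (a, b, c, d) (a', b', c', d')) z = mobius (a, b, c, d) (mobius (a', b', c', d') z)"
proof -
  have 1: "of_int c' * z + of_int d' \<noteq> 0" by (rule denominator_nonzero) (use assms in auto)
  have "of_int c * mobius (a', b', c', d') z + of_int d \<noteq> 0"
    by (rule denominator_nonzero) (use assms mobius_uhp[OF z assms(3)] in auto)
  with 1 show ?thesis by (simp add: divide_simps) (simp add: algebra_simps)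
qed

lemma has_field_derivative_mobius:
  assumes "z \<in> uhp" "a * d - b * c = 1"
  shows "(mobius (a, b, c, d) has_field_derivative 1 / (of_int c * z + of_int d) ^ 2) (at z)"
proof -
  have nz: "of_int c * z + of_int d \<noteq> 0" by (rule denominator_nonzero[OF assms])
  have "complex_of_int (a * d - b * c) = 1" by (simp only: assms(2) of_int_1)
  hence det: "complex_of_int a * of_int d = 1 + of_int b * of_int c" by (simp add: algebra_simps)
  have "mobius (a, b, c, d) = (\<lambda>z. (of_int a * z + of_int b) / (of_int c * z + of_int d))"
    by auto
  moreover have "((\<lambda>z. (of_int a * z + of_int b) / (of_int c * z + of_int d)) has_field_derivative
      (of_int a * (of_int c * z + of_int d) - (of_int a * z + of_int b) * of_int c)
        / ((of_int c * z + of_int d) * (of_int c * z + of_int d))) (at z)"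
    by (rule derivative_eq_intros refl nz)+ simp
  moreover have "of_int a * (of_int c * z + of_int d) - (of_int a * z + of_int b) * of_int c = 1"
    using det by (simp add: algebra_simps)
  ultimately show ?thesis by (simp add: power2_eq_square)
qed

text \<open>The row vector \<open>(c x + d, - (a x + b))\<close> times the matrix is
  \<open>(1, - x)\<close>: the form vanishing at the image of \<open>x\<close> pulls back to
  \<open>z - x\<close>.\<close>

lemma bottom_minus_top_row:
  fixes x :: "'a :: comm_ring_1"
  assumes "a * d - b * c = 1"
  shows "(of_int c * x + of_int d) * of_int a - (of_int a * x + of_int b) * of_int c = 1"
    and "(of_int c * x + of_int d) * of_int b - (of_int a * x + of_int b) * of_int d = - x"
proof -
  have "(of_int c * x + of_int d) * of_int a - (of_int a * x + of_int b) * of_int c = of_int (a * d - b * c)"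
    "(of_int c * x + of_int d) * of_int b - (of_int a * x + of_int b) * of_int d = - x * of_int (a * d - b * c)"
    by (simp_all add: algebra_simps)
  thus "(of_int c * x + of_int d) * of_int a - (of_int a * x + of_int b) * of_int c = 1"
    "(of_int c * x + of_int d) * of_int b - (of_int a * x + of_int b) * of_int d = - x"
    by (simp_all add: assms)
qed

lemma Gamma1_SL2: "(a, b, c, d) \<in> Gamma1 N \<Longrightarrow> a * d - b * c = 1"
  by (simp add: Gamma1_def)

lemma SL2_mult_Gamma1:
  assumes "g \<in> Gamma1 N" "g' \<in> Gamma1 N"
  shows "SL2_mult g g' \<in> Gamma1 N"
proof -
  obtain a b c d where g: "g = (a, b, c, d)" by (cases g)
  obtain a' b' c' d' where g': "g' = (a', b', c', d')" by (cases g')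
  have A: "a * d - b * c = 1" "[c = 0] (mod int N)" "[a = 1] (mod int N)" "[d = 1] (mod int N)"
    and B: "a' * d' - b' * c' = 1" "[c' = 0] (mod int N)" "[a' = 1] (mod int N)" "[d' = 1] (mod int N)"
    using assms by (auto simp: g g' Gamma1_def)
  have "(a * a' + b * c') * (c * b' + d * d') - (a * b' + b * d') * (c * a' + d * c')
      = (a * d - b * c) * (a' * d' - b' * c')" by (simp add: algebra_simps)
  moreover have "[c * a' + d * c' = 0 * a' + d * 0] (mod int N)"
    by (intro cong_add cong_mult A B cong_refl)
  moreover have "[a * a' + b * c' = 1 * 1 + b * 0] (mod int N)"
    by (intro cong_add cong_mult A B cong_refl)
  moreover have "[c * b' + d * d' = 0 * b' + 1 * 1] (mod int N)"
    by (intro cong_add cong_mult A B cong_refl)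
  ultimately show ?thesis by (simp add: g g' Gamma1_def A B)
qed

subsection \<open>Eichler integrals and periods\<close>

locale modular_qseries =
  fixes c :: "nat \<Rightarrow> complex" and N k :: nat
  assumes disc: "disc_summable c" and k: "k \<ge> 2"
    and modular: "\<And>\<alpha> \<beta> \<gamma> \<delta> z. (\<alpha>, \<beta>, \<gamma>, \<delta>) \<in> Gamma1 N \<Longrightarrow> z \<in> uhp \<Longrightarrow>
      qseries c (mobius (\<alpha>, \<beta>, \<gamma>, \<delta>) z) = (of_int \<gamma> * z + of_int \<delta>) ^ k * qseries c z"
begin

definition Eichler :: "complex \<Rightarrow> complex \<Rightarrow> complex \<Rightarrow> complex" where
  "Eichler u v z = qprim (k - 2) c u v z"

lemma Eichler_scale: "Eichler (s * u) (s * v) z = s ^ (k - 2) * Eichler u v z"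
  unfolding Eichler_def by (rule qprim_scale)

lemma Eichler_deriv:
  "z \<in> uhp \<Longrightarrow> (Eichler u v has_field_derivative qseries c z * (u * z + v) ^ (k - 2)) (at z)"
  unfolding Eichler_def[abs_def] by (rule has_field_derivative_qprim[OF disc])

lemma Eichler_tendsto: "((\<lambda>t. Eichler u v (of_real x + \<i> * of_real t)) \<longlongrightarrow> 0) at_top"
  unfolding Eichler_def by (rule tendsto_qprim[OF disc])

text \<open>The weight splits as \<open>2 + (k - 2)\<close>: the \<open>k - 2\<close> factors clear
  the denominator of the transformed linear form, and the other two are left to cancel the
  derivative of the Moebius map.\<close>

lemma modular_weighted:
  assumes g: "(\<alpha>, \<beta>, \<gamma>, \<delta>) \<in> Gamma1 N" and z: "z \<in> uhp"
  shows "qseries c (mobius (\<alpha>, \<beta>, \<gamma>, \<delta>) z) * (u * mobius (\<alpha>, \<beta>, \<gamma>, \<delta>) z + v) ^ (k - 2)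
    = (of_int \<gamma> * z + of_int \<delta>) ^ 2 *
      (qseries c z * ((u * of_int \<alpha> + v * of_int \<gamma>) * z + (u * of_int \<beta> + v * of_int \<delta>)) ^ (k - 2))"
proof -
  define j where "j = of_int \<gamma> * z + of_int \<delta>"
  have nz: "j \<noteq> 0" unfolding j_def by (rule denominator_nonzero[OF z Gamma1_SL2[OF g]])
  have "mobius (\<alpha>, \<beta>, \<gamma>, \<delta>) z = (of_int \<alpha> * z + of_int \<beta>) / j"
    by (simp add: j_def)
  moreover have "u * (X / j) + v = (u * X + v * j) / j" for X
    using nz by (simp add: add_divide_distrib)
  ultimately have "u * mobius (\<alpha>, \<beta>, \<gamma>, \<delta>) z + v = (u * (of_int \<alpha> * z + of_int \<beta>) + v * j) / j"
    by (simp only:)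
  also have "u * (of_int \<alpha> * z + of_int \<beta>) + v * j =
      (u * of_int \<alpha> + v * of_int \<gamma>) * z + (u * of_int \<beta> + v * of_int \<delta>)"
    by (simp add: j_def algebra_simps)
  finally have "u * mobius (\<alpha>, \<beta>, \<gamma>, \<delta>) z + v =
     ((u * of_int \<alpha> + v * of_int \<gamma>) * z + (u * of_int \<beta> + v * of_int \<delta>)) / j" .
  moreover have "j ^ k = j ^ 2 * j ^ (k - 2)" using k by (metis le_add_diff_inverse power_add)
  ultimately show ?thesis
    using nz by (simp add: modular[OF g z] j_def[symmetric] power_divide del: mobius.simps)
qed

text \<open>By \<open>modular_weighted\<close> both primitives have the same derivative on the
  convex set \<open>uhp\<close>. The constant \<open>L\<close> depends on the matrix and on
  \<open>u\<close>, \<open>v\<close>, but not on \<open>z\<close>.\<close>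

lemma Eichler_cocycle:
  assumes g: "(\<alpha>, \<beta>, \<gamma>, \<delta>) \<in> Gamma1 N"
  obtains L where "\<And>z. z \<in> uhp \<Longrightarrow> Eichler u v (mobius (\<alpha>, \<beta>, \<gamma>, \<delta>) z) =
    Eichler (u * of_int \<alpha> + v * of_int \<gamma>) (u * of_int \<beta> + v * of_int \<delta>) z + L"
proof -
  let ?g = "mobius (\<alpha>, \<beta>, \<gamma>, \<delta>)"
  let ?u = "u * of_int \<alpha> + v * of_int \<gamma>" and ?v = "u * of_int \<beta> + v * of_int \<delta>"
  have "((\<lambda>z. Eichler u v (?g z) - Eichler ?u ?v z) has_field_derivative 0) (at z within uhp)"
    if z: "z \<in> uhp" for z
  proof -
    have nz: "of_int \<gamma> * z + of_int \<delta> \<noteq> 0" by (rule denominator_nonzero[OF z Gamma1_SL2[OF g]])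
    have "((\<lambda>z. Eichler u v (?g z) - Eichler ?u ?v z) has_field_derivative
        (qseries c (?g z) * (u * ?g z + v) ^ (k - 2)) * (1 / (of_int \<gamma> * z + of_int \<delta>) ^ 2)
         - qseries c z * (?u * z + ?v) ^ (k - 2)) (at z)"
      by (intro DERIV_diff DERIV_chain2[OF Eichler_deriv] Eichler_deriv z
           mobius_uhp has_field_derivative_mobius Gamma1_SL2[OF g])
    thus ?thesis
      unfolding modular_weighted[OF g z] using nz by (simp add: has_field_derivative_at_within del: mobius.simps)
  qed
  from has_field_derivative_zero_constant[OF convex_uhp this]
  obtain L where "\<And>z. z \<in> uhp \<Longrightarrow> Eichler u v (?g z) - Eichler ?u ?v z = L" by blast
  thus ?thesis using that[of L] by (simp add: algebra_simps del: mobius.simps)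
qed

text \<open>Here the additive constant of the cocycle vanishes, as both sides tend to 0 at infinity.\<close>
lemma Eichler_parabolic:
  assumes g: "(\<alpha>, \<beta>, 0, \<delta>) \<in> Gamma1 N" and z: "z \<in> uhp"
  shows "Eichler u v (mobius (\<alpha>, \<beta>, 0, \<delta>) z) = Eichler (u * of_int \<alpha>) (u * of_int \<beta> + v * of_int \<delta>) z"
proof -
  obtain L where L: "\<And>z. z \<in> uhp \<Longrightarrow> Eichler u v (mobius (\<alpha>, \<beta>, 0, \<delta>) z) =
    Eichler (u * of_int \<alpha> + v * of_int 0) (u * of_int \<beta> + v * of_int \<delta>) z + L"
    using Eichler_cocycle[OF g] by blast
  have "\<alpha> * \<delta> = 1" using Gamma1_SL2[OF g] by simp
  hence "\<alpha> = 1 \<and> \<delta> = 1 \<or> \<alpha> = - 1 \<and> \<delta> = - 1" by (rule zmult_eq_1_iff[THEN iffD1])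
  hence mob: "mobius (\<alpha>, \<beta>, 0, \<delta>) (of_real 0 + \<i> * of_real t) = of_real (of_int (\<beta> * \<delta>)) + \<i> * of_real t" for t
    by auto
  have "((\<lambda>t. Eichler u v (of_real (of_int (\<beta> * \<delta>)) + \<i> * of_real t)
         - Eichler (u * of_int \<alpha> + v * of_int 0) (u * of_int \<beta> + v * of_int \<delta>) (of_real 0 + \<i> * of_real t))
         \<longlongrightarrow> 0 - 0) at_top"
    by (intro tendsto_diff Eichler_tendsto)
  moreover have "eventually (\<lambda>t. Eichler u v (of_real (of_int (\<beta> * \<delta>)) + \<i> * of_real t)
         - Eichler (u * of_int \<alpha> + v * of_int 0) (u * of_int \<beta> + v * of_int \<delta>) (of_real 0 + \<i> * of_real t) = L) at_top"
    using eventually_gt_at_top[of 0]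
  proof eventually_elim
    case (elim t)
    hence "of_real 0 + \<i> * of_real t \<in> uhp" by (simp add: uhp_def)
    from L[OF this] show ?case unfolding mob by simp
  qed
  ultimately have "((\<lambda>t::real. L) \<longlongrightarrow> 0) at_top"
    by (subst (asm) tendsto_cong) auto
  hence "L = 0" by (simp add: tendsto_const_iff)
  thus ?thesis using L[OF z] by simp
qed

text \<open>The vertical ray over the cusp \<open>g \<infinity>\<close> is the image under \<open>g\<close> of another vertical ray, so both
  ends of the path are governed by the decay of the q-series at infinity.\<close>
lemma integral_to_cusp:
  assumes g: "(\<alpha>, \<beta>, \<gamma>, \<delta>) \<in> Gamma1 N" and \<gamma>: "\<gamma> \<noteq> 0" and z: "z \<in> uhp"
  shows "integral_inf_to (\<lambda>w. qseries c w * (w - of_real x) ^ (k - 2)) (of_int \<alpha> / of_int \<gamma>) =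
    Eichler 1 (- of_real x) (mobius (\<alpha>, \<beta>, \<gamma>, \<delta>) z) -
    Eichler (of_int \<alpha> - of_real x * of_int \<gamma>) (of_int \<beta> - of_real x * of_int \<delta>) z"
proof -
  let ?g = "mobius (\<alpha>, \<beta>, \<gamma>, \<delta>)"
  define r where "r = real_of_int \<alpha> / real_of_int \<gamma>"
  define u v where "u = of_int \<alpha> - complex_of_real x * of_int \<gamma>" and "v = of_int \<beta> - complex_of_real x * of_int \<delta>"
  obtain L where L: "\<And>z. z \<in> uhp \<Longrightarrow> Eichler 1 (- of_real x) (?g z) =
    Eichler (1 * of_int \<alpha> + - of_real x * of_int \<gamma>) (1 * of_int \<beta> + - of_real x * of_int \<delta>) z + L"
    using Eichler_cocycle[OF g, of 1 "- of_real x"] by blast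
  hence L: "Eichler 1 (- of_real x) (?g z) = Eichler u v z + L" if "z \<in> uhp" for z
    using that by (simp add: u_def v_def del: mobius.simps)
  \<comment> \<open>\<open>y\<close> is the preimage of infinity. The matrix carries the ray
    \<open>y + \<i> * \<sigma> t\<close> to the ray \<open>r + \<i> * t\<close>, with reversed
    direction.\<close>
  define y where "y = - real_of_int \<delta> / real_of_int \<gamma>"
  define w where "w \<sigma> = complex_of_real y + \<i> * of_real \<sigma>" for \<sigma>
  define \<sigma> where "\<sigma> t = 1 / ((real_of_int \<gamma>)\<^sup>2 * t)" for t
  have w: "w (\<sigma> t) \<in> uhp" if "t > 0" for t
    using that \<gamma> by (simp add: w_def \<sigma>_def uhp_def zero_less_mult_iff)
  have den: "of_int \<gamma> * w s + of_int \<delta> = \<i> * of_int \<gamma> * of_real s" for s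
    using \<gamma> by (simp add: w_def y_def field_simps)
  have det: "complex_of_int \<alpha> * of_int \<delta> = 1 + of_int \<beta> * of_int \<gamma>"
  proof -
    have "complex_of_int (\<alpha> * \<delta> - \<beta> * \<gamma>) = 1" by (simp only: Gamma1_SL2[OF g] of_int_1)
    thus ?thesis by (simp add: algebra_simps)
  qed
  have gw: "?g (w (\<sigma> t)) = of_real r + \<i> * of_real t" if "t > 0" for t
  proof -
    have "\<i> * of_int \<gamma> * of_real (\<sigma> t) \<noteq> 0" using that \<gamma> by (simp add: \<sigma>_def)
    moreover have "of_int \<alpha> * w (\<sigma> t) + of_int \<beta> =
        (of_real r + \<i> * of_real t) * (\<i> * of_int \<gamma> * of_real (\<sigma> t))"
    proof -
      have 1: "of_int \<alpha> * complex_of_real y + of_int \<beta> = - 1 / of_int \<gamma>"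
        using \<gamma> det by (simp add: y_def field_simps)
      have 2: "complex_of_real t * of_int \<gamma> * of_real (\<sigma> t) = 1 / of_int \<gamma>"
        using \<gamma> that by (simp add: \<sigma>_def power2_eq_square)
      have 3: "complex_of_real r * of_int \<gamma> = of_int \<alpha>" using \<gamma> by (simp add: r_def)
      have "of_int \<alpha> * w (\<sigma> t) + of_int \<beta> =
          (of_int \<alpha> * of_real y + of_int \<beta>) + \<i> * of_int \<alpha> * of_real (\<sigma> t)"
        by (simp add: w_def algebra_simps)
      also have "\<dots> = - (complex_of_real t * of_int \<gamma> * of_real (\<sigma> t))
          + \<i> * (complex_of_real r * of_int \<gamma>) * of_real (\<sigma> t)"
        unfolding 1 2 3 by simp
      finally show ?thesis by (simp add: algebra_simps)
    qed
    ultimately show ?thesis unfolding mobius.simps den by (simp add: field_simps)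
  qed
  have \<sigma>_lim: "filterlim \<sigma> at_top (at_right 0)"
    unfolding \<sigma>_def using \<gamma> by real_asymp
  let ?f = "\<lambda>t. qseries c (of_real r + \<i> * of_real t) * (1 * (of_real r + \<i> * of_real t) + - of_real x) ^ (k - 2) * \<i>"
  let ?F = "\<lambda>t. Eichler 1 (- of_real x) (of_real r + \<i> * of_real t)"
  have line: "of_real r + \<i> * of_real t \<in> uhp" if "t > 0" for t using that by (simp add: uhp_def)
  \<comment> \<open>The primitive tends to 0 at infinity and to \<open>L\<close> at the cusp; the
    minus sign in \<open>integral_inf_to\<close> makes the result \<open>L\<close>.\<close>
  have "integral {0<..} ?f = 0 - L"
  proof (rule integral_positive_reals_FTC)
    show "continuous_on {0<..} ?f"
      by (intro continuous_intros continuous_on_compose2[OF continuous_on_qseries[OF disc]])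
         (use line in auto)
    show "(?F has_vector_derivative ?f t) (at t)" if "t > 0" for t
    proof -
      have "((\<lambda>t. of_real r + \<i> * complex_of_real t) has_vector_derivative \<i>) (at t)"
        by (auto intro!: derivative_eq_intros)
      from field_vector_diff_chain_at[OF this
           Eichler_deriv[OF line[OF that], where u = 1 and v = "- of_real x"]]
      show ?thesis by (simp add: o_def mult_ac)
    qed
    have "((\<lambda>t. exp t *\<^sub>R (qseries c (of_real r + \<i> * of_real t) *
             (1 * (of_real r + \<i> * of_real t) + - of_real x) ^ (k - 2)) * \<i>) \<longlongrightarrow> 0 * \<i>) at_top"
      by (intro tendsto_mult tendsto_const tendsto_exp_qseries_power disc)
    thus "((\<lambda>t. exp t *\<^sub>R ?f t) \<longlongrightarrow> 0) at_top" by simp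
    show "(?F \<longlongrightarrow> 0) at_top" by (rule Eichler_tendsto)
    have "((\<lambda>t. Eichler u v (w (\<sigma> t)) + L) \<longlongrightarrow> 0 + L) (at_right 0)"
      unfolding w_def by (intro tendsto_add tendsto_const filterlim_compose[OF Eichler_tendsto \<sigma>_lim])
    moreover have "eventually (\<lambda>t. ?F t = Eichler u v (w (\<sigma> t)) + L) (at_right 0)"
      using eventually_at_right_less[of 0]
    proof eventually_elim
      case (elim t)
      show ?case using L[OF w[OF elim]] unfolding gw[OF elim] .
    qed
    ultimately show "(?F \<longlongrightarrow> L) (at_right 0)"
      by (subst tendsto_cong) auto
    \<comment> \<open>The squared denominator grows like \<open>s ^ 2\<close>; the spare factor
      \<open>exp s\<close> in the decay of the q-series outweighs it.\<close>
    have eq: "complex_of_real (exp (- s) * s\<^sup>2) * (\<i> * of_int \<gamma>)\<^sup>2 * exp s *\<^sub>R X * \<i>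
        = (of_int \<gamma> * w s + of_int \<delta>) ^ 2 * X * \<i>" for s X
      unfolding den by (simp add: power_mult_distrib scaleR_conv_of_real exp_minus field_simps)
    have "((\<lambda>s. complex_of_real (exp (- s) * s\<^sup>2) * (\<i> * of_int \<gamma>)\<^sup>2 *
            exp s *\<^sub>R (qseries c (w s) * (u * w s + v) ^ (k - 2)) * \<i>) \<longlongrightarrow>
          of_real 0 * (\<i> * of_int \<gamma>)\<^sup>2 * 0 * \<i>) at_top"
    proof (intro tendsto_mult tendsto_const tendsto_of_real)
      show "((\<lambda>s::real. exp (- s)  * s\<^sup>2) \<longlongrightarrow> 0) at_top" by real_asymp
      show "((\<lambda>s. exp s *\<^sub>R (qseries c (w s) * (u * w s + v) ^ (k - 2))) \<longlongrightarrow> 0) at_top"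
        unfolding w_def by (rule tendsto_exp_qseries_power[OF disc])
    qed
    hence "((\<lambda>s. (of_int \<gamma> * w s + of_int \<delta>) ^ 2 * (qseries c (w s) * (u * w s + v) ^ (k - 2)) * \<i>) \<longlongrightarrow> 0) at_top"
      by (simp only: eq mult_zero_right mult_zero_left of_real_0)
    hence "((\<lambda>t. (of_int \<gamma> * w (\<sigma> t) + of_int \<delta>) ^ 2 *
        (qseries c (w (\<sigma> t)) * (u * w (\<sigma> t) + v) ^ (k - 2)) * \<i>) \<longlongrightarrow> 0) (at_right 0)"
      by (rule filterlim_compose[OF _ \<sigma>_lim])
    moreover have "eventually (\<lambda>t. ?f t = (of_int \<gamma> * w (\<sigma> t) + of_int \<delta>) ^ 2 *
        (qseries c (w (\<sigma> t)) * (u * w (\<sigma> t) + v) ^ (k - 2)) * \<i>) (at_right 0)"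
      using eventually_at_right_less[of 0]
    proof eventually_elim
      case (elim t)
      have "u = 1 * of_int \<alpha> + - of_real x * of_int \<gamma>" "v = 1 * of_int \<beta> + - of_real x * of_int \<delta>"
        by (simp_all add: u_def v_def)
      thus ?case
        using modular_weighted[OF g w[OF elim], of 1 "- of_real x"] unfolding gw[OF elim] by simp
    qed
    ultimately show "(?f \<longlongrightarrow> 0) (at_right 0)"
      by (subst tendsto_cong) auto
  qed
  hence "integral_inf_to (\<lambda>w. qseries c w * (w - of_real x) ^ (k - 2)) r = L"
    by (simp add: integral_inf_to_def)
  thus ?thesis using L[OF z] by (simp add: r_def u_def v_def del: mobius.simps)
qed

definition cusp_integral :: "real option \<Rightarrow> complex" where
  "cusp_integral x = (case x of None \<Rightarrow> 0
     | Some a \<Rightarrow> integral_inf_to (\<lambda>z. qseries c z * (z - of_real a) ^ (k - 2)) a)"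

text \<open>The coefficients of the second term are \<open>j(g, x)\<close> times those of \<open>z - g x\<close>, which keeps the
  expression polynomial in \<open>x\<close> and meaningful when \<open>g x = \<infinity>\<close>.\<close>
definition period :: "int \<times> int \<times> int \<times> int \<Rightarrow> real \<Rightarrow> complex \<Rightarrow> complex" where
  "period g x w = (case g of (\<alpha>, \<beta>, \<gamma>, \<delta>) \<Rightarrow> Eichler 1 (- of_real x) w -
     Eichler (of_int \<gamma> * of_real x + of_int \<delta>) (- (of_int \<alpha> * of_real x + of_int \<beta>)) (mobius g w))"

text \<open>By \<open>bottom_minus_top_row\<close> the second linear form pulls back to the first,
  so the two terms of \<open>period\<close> differ by a cocycle constant.\<close>

lemma period_independent:
  assumes g: "g \<in> Gamma1 N" and w: "w \<in> uhp" "w' \<in> uhp"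
  shows "period g x w = period g x w'"
proof -
  obtain \<alpha> \<beta> \<gamma> \<delta> where g_eq: "g = (\<alpha>, \<beta>, \<gamma>, \<delta>)" by (cases g)
  let ?u = "of_int \<gamma> * complex_of_real x + of_int \<delta>" and ?v = "- (of_int \<alpha> * complex_of_real x + of_int \<beta>)"
  have det: "\<alpha> * \<delta> - \<beta> * \<gamma> = 1" using Gamma1_SL2 g by (simp add: g_eq)
  have "?u * of_int \<alpha> + ?v * of_int \<gamma> = 1" "?u * of_int \<beta> + ?v * of_int \<delta> = - of_real x"
    using bottom_minus_top_row[OF det, of "complex_of_real x"]
    by (simp_all only: mult_minus_left add_uminus_conv_diff)
  with Eichler_cocycle[OF g[unfolded g_eq], of ?u ?v] obtain L where
    "\<And>z. z \<in> uhp \<Longrightarrow> Eichler ?u ?v (mobius (\<alpha>, \<beta>, \<gamma>, \<delta>) z) = Eichler 1 (- of_real x) z + L"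
    by metis
  thus ?thesis using w by (simp add: period_def g_eq del: mobius.simps)
qed

lemma cusp_integral_period:
  assumes g: "(\<alpha>, \<beta>, \<gamma>, \<delta>) \<in> Gamma1 N" and x: "Some x \<in> cusp_orbit_inf (Gamma1 N)"
  shows "cusp_integral (Some x) - complex_of_real (of_int \<gamma> * x + of_int \<delta>) ^ (k - 2)
           * cusp_integral (moeb (\<alpha>, \<beta>, \<gamma>, \<delta>) (Some x)) = period (\<alpha>, \<beta>, \<gamma>, \<delta>) x \<i>"
proof -
  obtain a b c' d where h: "(a, b, c', d) \<in> Gamma1 N" and "moeb (a, b, c', d) None = Some x"
    using x unfolding cusp_orbit_inf_def by force
  hence c': "c' \<noteq> 0" and x_eq: "x = of_int a / of_int c'" by (auto split: if_splits)
  have i: "\<i> \<in> uhp" by (simp add: uhp_def)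
  have det: "a * d - b * c' = 1" "\<alpha> * \<delta> - \<beta> * \<gamma> = 1" by (rule Gamma1_SL2[OF h] Gamma1_SL2[OF g])+
  define w where "w = mobius (a, b, c', d) \<i>"
  have w: "w \<in> uhp" unfolding w_def by (rule mobius_uhp[OF i det(1)])
  define A B C D where "A = \<alpha> * a + \<beta> * c'" and "B = \<alpha> * b + \<beta> * d"
    and "C = \<gamma> * a + \<delta> * c'" and "D = \<gamma> * b + \<delta> * d"
  have gh: "(A, B, C, D) \<in> Gamma1 N"
    using SL2_mult_Gamma1[OF g h] by (simp add: A_def B_def C_def D_def)
  have gw: "mobius (A, B, C, D) \<i> = mobius (\<alpha>, \<beta>, \<gamma>, \<delta>) w"
    using mobius_SL2_mult[OF i det(2) det(1)] unfolding w_def by (simp add: A_def B_def C_def D_def del: mobius.simps)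
  define j where "j = of_int \<gamma> * x + of_int \<delta>"
  define n where "n = of_int \<alpha> * x + of_int \<beta>"
  \<comment> \<open>Thus the lower left entry of the product matrix vanishes exactly when
    \<open>g\<close> sends \<open>x\<close> to infinity.\<close>
  have jc: "of_int C = j * of_int c'" and nc: "of_int A = n * of_int c'"
    using c' by (simp_all add: j_def n_def x_eq C_def A_def field_simps)
  \<comment> \<open>The tail shared by both integrals; the identities \<open>lin\<close> below show
    that the second one has the same coefficients.\<close>
  define E where "E = Eichler (of_int a - of_real x * of_int c') (of_int b - of_real x * of_int d) \<i>"
  have "complex_of_real j * of_int A - of_real n * of_int C =
      of_int a * (of_real j * of_int \<alpha> - of_real n * of_int \<gamma>) + of_int c' * (of_real j * of_int \<beta> - of_real n * of_int \<delta>)"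
    "complex_of_real j * of_int B - of_real n * of_int D =
      of_int b * (of_real j * of_int \<alpha> - of_real n * of_int \<gamma>) + of_int d * (of_real j * of_int \<beta> - of_real n * of_int \<delta>)"
    by (simp_all add: A_def B_def C_def D_def algebra_simps)
  moreover have "of_real j * of_int \<alpha> - of_real n * of_int \<gamma> = (1 :: complex)"
    "of_real j * of_int \<beta> - of_real n * of_int \<delta> = - complex_of_real x"
    using bottom_minus_top_row[OF det(2), of "complex_of_real x"] by (simp_all add: j_def n_def)
  ultimately have lin:
    "of_real j * of_int A - of_real n * of_int C = of_int a - of_real x * complex_of_int c'"
    "of_real j * of_int B - of_real n * of_int D = of_int b - of_real x * complex_of_int d"
    by simp_all
  have 1: "cusp_integral (Some x) = Eichler 1 (- of_real x) w - E"
    using integral_to_cusp[OF h c' i, of x] by (simp add: cusp_integral_def x_eq w_def E_def del: mobius.simps)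
  have 2: "of_real j ^ (k - 2) * cusp_integral (moeb (\<alpha>, \<beta>, \<gamma>, \<delta>) (Some x)) =
      Eichler (of_real j) (- of_real n) (mobius (\<alpha>, \<beta>, \<gamma>, \<delta>) w) - E"
  proof (cases "j = 0")
    \<comment> \<open>Here \<open>g x\<close> is infinity and its integral is 0 by definition, so
      \<open>0 ^ 0 = 1\<close> for \<open>k = 2\<close> does no harm. The product matrix fixes
      infinity, hence the right side vanishes too.\<close>
    case True
    hence C: "C = 0" using jc by simp
    have "moeb (\<alpha>, \<beta>, \<gamma>, \<delta>) (Some x) = None" using True by (simp add: j_def)
    moreover have "Eichler (of_real j) (- of_real n) (mobius (A, B, C, D) \<i>) = E"
      using Eichler_parabolic[of A B D \<i> "of_real j" "- of_real n"] gh i lin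
      by (simp add: C E_def del: mobius.simps)
    ultimately show ?thesis by (simp add: cusp_integral_def gw del: mobius.simps)
  next
    case False
    define y where "y = n / j"
    have C: "C \<noteq> 0" using jc False c' by (metis mult_eq_0_iff of_int_0_eq_iff)
    have y: "y = of_int A / of_int C" using c' False by (simp add: y_def jc nc)
    have m: "moeb (\<alpha>, \<beta>, \<gamma>, \<delta>) (Some x) = Some y" using False by (simp add: y_def n_def j_def)
    have jy: "of_real j * of_real y = complex_of_real n" using False by (simp add: y_def)
    have "cusp_integral (Some y) = Eichler 1 (- of_real y) (mobius (\<alpha>, \<beta>, \<gamma>, \<delta>) w) -
        Eichler (of_int A - of_real y * of_int C) (of_int B - of_real y * of_int D) \<i>"
      using integral_to_cusp[OF gh C i, of y] by (simp add: cusp_integral_def y gw del: mobius.simps)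
    hence "of_real j ^ (k - 2) * cusp_integral (Some y) =
        Eichler (of_real j * 1) (of_real j * - of_real y) (mobius (\<alpha>, \<beta>, \<gamma>, \<delta>) w) -
        Eichler (of_real j * (of_int A - of_real y * of_int C)) (of_real j * (of_int B - of_real y * of_int D)) \<i>"
      unfolding Eichler_scale by (simp add: right_diff_distrib del: mobius.simps)
    also have "of_real j * (of_int A - of_real y * of_int C) = of_int a - of_real x * complex_of_int c'"
      using lin(1) by (simp add: right_diff_distrib mult.assoc[symmetric] jy)
    also have "of_real j * (of_int B - of_real y * of_int D) = of_int b - of_real x * complex_of_int d"
      using lin(2) by (simp add: right_diff_distrib mult.assoc[symmetric] jy)
    finally show ?thesis unfolding m E_def by (simp add: jy del: mobius.simps)
  qed
  have "cusp_integral (Some x) - of_real j ^ (k - 2) * cusp_integral (moeb (\<alpha>, \<beta>, \<gamma>, \<delta>) (Some x))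
      = period (\<alpha>, \<beta>, \<gamma>, \<delta>) x w"
    unfolding 1 2 by (simp add: period_def j_def n_def del: mobius.simps)
  \<comment> \<open>\<open>w\<close> depends on the cusp \<open>x\<close>; passing to
    \<open>\<i>\<close> leaves an expression that is continuous in \<open>x\<close>.\<close>
  also have "\<dots> = period (\<alpha>, \<beta>, \<gamma>, \<delta>) x \<i>" by (rule period_independent[OF g w i])
  finally show ?thesis by (simp only: j_def)
qed

lemma continuous_on_period: "continuous_on S (\<lambda>x. period g x w)"
proof -
  obtain \<alpha> \<beta> \<gamma> \<delta> where g: "g = (\<alpha>, \<beta>, \<gamma>, \<delta>)" by (cases g)
  show ?thesis
    unfolding period_def g prod.case Eichler_def
    by (intro continuous_intros continuous_on_qprim)
qed

lemma quantum_modular_cusp_integral: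
  "quantum_modular_form (Gamma1 N) (2 - int k) (\<lambda>x. C * cusp_integral x)"
  unfolding quantum_modular_form_def
proof (intro conjI ballI)
  show "2 - int k \<le> 0" using k by simp
  fix g assume g: "g \<in> Gamma1 N"
  obtain \<alpha> \<beta> \<gamma> \<delta> where g_eq: "g = (\<alpha>, \<beta>, \<gamma>, \<delta>)" by (cases g)
  have "- (2 - int k) = int (k - 2)" using k by simp
  have "C * cusp_integral (Some x) - complex_of_real (jfac g x) powi (- (2 - int k)) *
      (C * cusp_integral (moeb g (Some x))) = C * period g x \<i>"
    if "x \<in> {x. Some x \<in> cusp_orbit_inf (Gamma1 N)}" for x
  proof -
    have "cusp_integral (Some x) - complex_of_real (jfac g x) ^ (k - 2) * cusp_integral (moeb g (Some x))
        = period g x \<i>"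
      using cusp_integral_period[of \<alpha> \<beta> \<gamma> \<delta> x] g that by (simp only: g_eq jfac.simps mem_Collect_eq)
    hence "C * cusp_integral (Some x) - complex_of_real (jfac g x) ^ (k - 2) * (C * cusp_integral (moeb g (Some x)))
        = C * period g x \<i>"
      by (metis mult.left_commute right_diff_distrib)
    thus ?thesis by (simp only: \<open>- (2 - int k) = int (k - 2)\<close> power_int_of_nat)
  qed
  thus "continuous_on {x. Some x \<in> cusp_orbit_inf (Gamma1 N)}
     (\<lambda>x. C * cusp_integral (Some x) - complex_of_real (jfac g x) powi (- (2 - int k)) *
      (C * cusp_integral (moeb g (Some x))))"
    by (simp only: continuous_on_mult continuous_on_const continuous_on_period cong: continuous_on_cong)
qed

end

subsection \<open>Dirichlet characters\<close>

lemma dirichlet_char_modulus_1: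
  assumes "dirichlet_char 1 chi"
  shows "chi n = 1"
proof -
  have per: "chi (m + int 1) = chi m" for m using assms unfolding dirichlet_char_def by blast
  have "chi (0 * 0) = chi 0 * chi 0" using assms unfolding dirichlet_char_def by blast
  moreover have "chi 0 \<noteq> 0" using assms by (simp add: dirichlet_char_def)
  ultimately have "chi 0 = 1" by simp
  moreover have "chi (0 + n) = chi 0" by (rule periodic_dvd[of chi 1, OF per]) simp
  ultimately show ?thesis by simp
qed

text \<open>0 is coprime only to the modulus 1, for which every character is constantly 1;
  nontriviality excludes this case.\<close>

lemma nontrivial_dirichlet_char_0:
  assumes "dirichlet_char q chi" "nontrivial_dirichlet_char q chi"
  shows "chi 0 = 0"
proof -
  have "q \<noteq> 1"
    using assms dirichlet_char_modulus_1[of chi] by (auto simp: nontrivial_dirichlet_char_def)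
  hence "\<not> coprime 0 (int q)" by simp
  thus ?thesis using assms(1) unfolding dirichlet_char_def by blast
qed

lemma dirichlet_char_uminus:
  assumes "dirichlet_char q chi"
  shows "chi (- n) = chi (- 1) * chi n"
proof -
  have "chi (- 1 * n) = chi (- 1) * chi n" using assms unfolding dirichlet_char_def by blast
  thus ?thesis by simp
qed

text \<open>The square of \<open>chi (- 1)\<close> is 1, so the value is real and the parity
  condition on \<open>chi2\<close> passes to its conjugate.\<close>

lemma cnj_dirichlet_char_minus_1:
  assumes "dirichlet_char q chi"
  shows "cnj (chi (- 1)) = chi (- 1)"
proof -
  have mult: "chi (m * n) = chi m * chi n" for m n using assms unfolding dirichlet_char_def by blast
  have "chi 1 \<noteq> 0" using assms by (simp add: dirichlet_char_def)
  hence "chi 1 = 1" using mult[of 1 1] by simp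
  hence "chi (- 1) ^ 2 = 1" using mult[of "- 1" "- 1"] by (simp add: power2_eq_square)
  hence "chi (- 1) = 1 \<or> chi (- 1) = - 1" by (rule power2_eq_1_iff[THEN iffD1])
  thus ?thesis by auto
qed

theorem theorem1p11:
  fixes chi1 chi2 :: "int \<Rightarrow> complex" and q1 q2 k :: nat
  assumes "k \<ge> 2"
    and "primitive_dirichlet_char q1 chi1" and "nontrivial_dirichlet_char q1 chi1"
    and "primitive_dirichlet_char q2 chi2" and "nontrivial_dirichlet_char q2 chi2"
    and "chi1 (-1) * chi2 (-1) = (-1) ^ k"
  shows "quantum_modular_form (Gamma1 (q1 * q2)) (2 - int k) (S_hat chi1 chi2 k q1)"
proof -
  have char: "dirichlet_char q1 chi1" "dirichlet_char q2 chi2"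
    using assms by (auto simp: primitive_dirichlet_char_def)
  interpret eisenstein_pair chi1 "\<lambda>n. cnj (chi2 n)" q1 q2 k "chi1 (- 1)" "cnj (chi2 (- 1))"
  proof
    show "q1 > 0" "q2 > 0" using char by (auto simp: dirichlet_char_def)
    show "chi1 (n + int q1) = chi1 n" "cnj (chi2 (n + int q2)) = cnj (chi2 n)" for n
      using char by (simp_all add: dirichlet_char_def)
    show "chi1 0 = 0" "cnj (chi2 0) = 0"
      using nontrivial_dirichlet_char_0 char assms by auto
    show "chi1 (- n) = chi1 (- 1) * chi1 n" "cnj (chi2 (- n)) = cnj (chi2 (- 1)) * cnj (chi2 n)" for n
      using dirichlet_char_uminus char by (metis complex_cnj_mult)+
    show "chi1 (- 1) * cnj (chi2 (- 1)) = (- 1) ^ k"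
      using assms(6) cnj_dirichlet_char_minus_1[OF char(2)] by simp
  qed (fact assms(1))
  \<comment> \<open>The factor 2 in front of the Eisenstein series is absorbed into the
    coefficients.\<close>
  let ?c = "\<lambda>n. 2 * coeff n"
  have qseries: "qseries ?c z = 2 * qseries coeff z" if "z \<in> uhp" for z
    by (rule qseries_cmult[OF disc_summable_coeff that])
  interpret modular_qseries ?c "q1 * q2" k
  proof
    show "disc_summable ?c"
      using disc_summable_coeff by (auto simp: disc_summable_def mult.assoc intro: summable_mult)
    fix a b c d :: int and z assume g: "(a, b, c, d) \<in> Gamma1 (q1 * q2)" and z: "z \<in> uhp"
    have det: "a * d - b * c = 1" by (rule Gamma1_SL2[OF g])
    have z': "mobius (a, b, c, d) z \<in> uhp" by (rule mobius_uhp[OF z det])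
    have "qseries coeff (mobius (a, b, c, d) z) = (of_int c * z + of_int d) ^ k * qseries coeff z"
      unfolding mobius.simps
      by (rule qseries_coeff_modular[OF z det])
         (use g z' denominator_nonzero[OF z det] in \<open>auto simp: Gamma1_def\<close>)
    thus "qseries ?c (mobius (a, b, c, d) z) = (of_int c * z + of_int d) ^ k * qseries ?c z"
      using qseries[OF z] qseries[OF z'] by simp
  qed (fact assms(1))
  have eis: "eisenstein chi1 chi2 k z = qseries ?c z" if "z \<in> uhp" for z
    unfolding qseries[OF that] by (simp add: eisenstein_def qseries_def eis_coeff_def coeff_def)
  \<comment> \<open>The Eisenstein series is replaced by the q-series only in the upper half plane,
    which contains the open ray of integration.\<close>
  have "integral_inf_to (\<lambda>z. eisenstein chi1 chi2 k z * (z - of_real a) ^ (k - 2)) a =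
      integral_inf_to (\<lambda>z. qseries ?c z * (z - of_real a) ^ (k - 2)) a" for a
    unfolding integral_inf_to_def
    by (intro arg_cong[of _ _ uminus] integral_cong) (simp add: eis uhp_def)
  hence "S_hat chi1 chi2 k q1 =
      (\<lambda>x. (-1) ^ k * gauss_sum q1 (\<lambda>n. cnj (chi1 n)) * of_nat (k - 1) * cusp_integral x)"
    by (auto simp: fun_eq_iff S_hat_def cusp_integral_def split: option.splits)
  thus ?thesis using quantum_modular_cusp_integral by simp
qed

end
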